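(* Let $s\in\{1,\dots,p\}$. Assume that the condition $WRE(s,7)$ holds for $\mathbb X$. Let $\hat{\boldsymbol\beta}$ be the Slope estimator with weights $\lambda_j=A\sigma\sqrt{\log(2p/j)/n}$, $j=1,\dots,p$, where $A\ge2(4+\sqrt2)$. Then, with probability at least $1-\frac12\left(\frac s{2p}\right)^{s/\vartheta^2(s,7)}$, $$\frac12|\hat{\boldsymbol\beta}-\boldsymbol\beta|_*+\|\mathbb X\hat{\boldsymbol\beta}-\mathbf f\|_n^2\le\|\mathbb X\boldsymbol\beta-\mathbf f\|_n^2+\frac{49\sum_{j=1}^s\lambda_j^2}{16\,\vartheta^2(s,7)}$$ for all $\boldsymbol\beta\in\mathbb R^p$ such that $|\boldsymbol\beta|_0\le s$, and all $\mathbf f\in\mathbb R^n$. Furthermore, if $\mathbf f=\mathbb X\boldsymbol\beta^*$ for some $\boldsymbol\beta^*\in\mathbb R^p$ with $|\boldsymbol\beta^*|_0\le s$, then $$\mathbb P\left(|\hat{\boldsymbol\beta}-\boldsymbol\beta^*|_2^2\le\frac{9\sum_{j=1}^s\lambda_j^2}{4\,\vartheta^4(s,3)}\right)\ge1-\frac12\left(\frac s{2p}\right)^{s/\vartheta^2(s,3)}.$$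
   Context: Let $n,p\ge1$ be integers, $\sigma>0$, $\mathbb X\in\mathbb R^{n\times p}$ a deterministic matrix, $\mathbf f\in\mathbb R^n$ deterministic, $\boldsymbol\xi\sim\mathcal N(\mathbf 0,\sigma^2I_{n\times n})$, $\mathbf y=\mathbf f+\boldsymbol\xi$. $\|\boldsymbol u\|_n^2=\frac1n\sum_{i=1}^nu_i^2$ for $\boldsymbol u\in\mathbb R^n$; $|\cdot|_q$ is the $\ell_q$ norm on $\mathbb R^p$; $|\boldsymbol\beta|_0$ is the number of nonzero components; $(\boldsymbol e_j)$ is the canonical basis of $\mathbb R^p$. For $\boldsymbol\beta\in\mathbb R^p$, $\beta_1^\sharp\ge\dots\ge\beta_p^\sharp$ is a non-increasing rearrangement of $|\beta_1|,\dots,|\beta_p|$. Sorted $\ell_1$ norm: $|\boldsymbol\beta|_*=\sum_{j=1}^p\lambda_j\beta_j^\sharp$. Slope estimator with weights $\lambda_1\ge\dots\ge\lambda_p\ge0$: any $\hat{\boldsymbol\beta}\in\arg\min_{\boldsymbol\beta\in\mathbb R^p}\big(\|\mathbb X\boldsymbol\beta-\mathbf y\|_n^2+2|\boldsymbol\beta|_*\big)$. Condition $WRE(s,c_0)$ ($c_0>0$, with the weights $\lambda_j$): $\|\mathbb X\boldsymbol e_j\|_n\le1$ for all $j=1,\dots,p$, and $$\vartheta(s,c_0)=\min_{\boldsymbol\delta\in\mathcal C_{WRE}(s,c_0),\,\boldsymbol\delta\ne\mathbf 0}\frac{\|\mathbb X\boldsymbol\delta\|_n}{|\boldsymbol\delta|_2}>0,\qquad\mathcal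 C_{WRE}(s,c_0)=\Big\{\boldsymbol\delta\in\mathbb R^p:|\boldsymbol\delta|_*\le(1+c_0)|\boldsymbol\delta|_2\sqrt{\textstyle\sum_{j=1}^s\lambda_j^2}\Big\}.$$ *)

theory Defs
  imports "HOL-Probability.Probability"
begin

definition emp_norm :: "real ^ 'n \<Rightarrow> real" where
  "emp_norm u = sqrt ((\<Sum>i\<in>UNIV. (u $ i)\<^sup>2) / real CARD('n))"

definition l0 :: "real ^ 'p \<Rightarrow> nat" where
  "l0 b = card {i. b $ i \<noteq> 0}"

text \<open>The index \<open>j\<close> of \<open>sharp b j\<close> ranges over \<open>1, \<dots>, CARD('p)\<close>, as do the indices of
  the weights \<open>lam\<close> below; the values outside this range are never used.\<close>

definition sharp :: "real ^ 'p \<Rightarrow> nat \<Rightarrow> real" where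
  "sharp b j =
     rev (sorted_list_of_multiset (image_mset (\<lambda>i. \<bar>b $ i\<bar>) (mset_set UNIV))) ! (j - 1)"

definition sorted_l1 :: "(nat \<Rightarrow> real) \<Rightarrow> real ^ 'p \<Rightarrow> real" where
  "sorted_l1 lam b = (\<Sum>j=1..CARD('p). lam j * sharp b j)"

text \<open>The minimizer need not be unique, hence a predicate.\<close>

definition slope_estimator ::
    "real ^ 'p ^ 'n \<Rightarrow> (nat \<Rightarrow> real) \<Rightarrow> real ^ 'n \<Rightarrow> real ^ 'p \<Rightarrow> bool" where
  "slope_estimator X lam y bhat \<longleftrightarrow>
     is_arg_min (\<lambda>b. (emp_norm (X *v b - y))\<^sup>2 + 2 * sorted_l1 lam b) (\<lambda>_. True) bhat"

definition wre_cone :: "(nat \<Rightarrow> real) \<Rightarrow> nat \<Rightarrow> real \<Rightarrow> (real ^ 'p) set" where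
  "wre_cone lam s c0 =
     {d. sorted_l1 lam d \<le> (1 + c0) * norm d * sqrt (\<Sum>j=1..s. (lam j)\<^sup>2)}"

text \<open>The infimum is attained whenever the cone is not \<open>{0}\<close>: the cone is closed and the
  quotient is invariant under scaling, so one may restrict to the compact set of unit vectors
  of the cone.\<close>

definition wre_const :: "real ^ 'p ^ 'n \<Rightarrow> (nat \<Rightarrow> real) \<Rightarrow> nat \<Rightarrow> real \<Rightarrow> real" where
  "wre_const X lam s c0 = (INF d\<in>wre_cone lam s c0 - {0}. emp_norm (X *v d) / norm d)"

definition WRE :: "real ^ 'p ^ 'n \<Rightarrow> (nat \<Rightarrow> real) \<Rightarrow> nat \<Rightarrow> real \<Rightarrow> bool" where
  "WRE X lam s c0 \<longleftrightarrow> (\<forall>j. emp_norm (X *v axis j 1) \<le> 1) \<and> wre_const X lam s c0 > 0"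

text \<open>\<open>\<xi>\<close> has the law \<open>N(0, \<sigma>\<^sup>2 I)\<close>. The second argument of \<open>normal_density\<close> is the
  standard deviation.\<close>

definition isotropic_normal :: "'w measure \<Rightarrow> real \<Rightarrow> ('w \<Rightarrow> real ^ 'n) \<Rightarrow> bool" where
  "isotropic_normal M \<sigma> \<xi> \<longleftrightarrow>
     prob_space.indep_vars M (\<lambda>_. borel) (\<lambda>i \<omega>. \<xi> \<omega> $ i) UNIV \<and>
     (\<forall>i. distributed M lborel (\<lambda>\<omega>. \<xi> \<omega> $ i) (\<lambda>x. ennreal (normal_density 0 \<sigma> x)))"

text \<open>``\<open>P\<close> holds with probability at least \<open>q\<close>'', for \<open>P\<close> whose truth set need not be
  measurable: a minimizer may be selected in a non-measurable way, and the condition may be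
  quantified over uncountably many parameters.\<close>

definition holds_with_prob :: "'w measure \<Rightarrow> real \<Rightarrow> ('w \<Rightarrow> bool) \<Rightarrow> bool" where
  "holds_with_prob M q P \<longleftrightarrow> (\<exists>E\<in>sets M. q \<le> measure M E \<and> (\<forall>\<omega>\<in>E. P \<omega>))"

lemma (in prob_space) holds_with_prob_iff_prob:
  assumes "{\<omega>\<in>space M. P \<omega>} \<in> events"
  shows "holds_with_prob M q P \<longleftrightarrow> q \<le> prob {\<omega>\<in>space M. P \<omega>}"
proof
  assume "holds_with_prob M q P"
  then obtain E where E: "E \<in> events" "q \<le> prob E" "\<forall>\<omega>\<in>E. P \<omega>"
    unfolding holds_with_prob_def by blast
  have "E \<subseteq> {\<omega>\<in>space M. P \<omega>}"
    using E sets.sets_into_space by blast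
  then have "prob E \<le> prob {\<omega>\<in>space M. P \<omega>}"
    using assms by (rule finite_measure_mono)
  with E(2) show "q \<le> prob {\<omega>\<in>space M. P \<omega>}" by linarith
next
  assume "q \<le> prob {\<omega>\<in>space M. P \<omega>}"
  with assms show "holds_with_prob M q P"
    unfolding holds_with_prob_def by blast
qed

end

theory Submission
  imports Defs
begin

text \<open>Everything deterministic comes from one inequality. The Slope objective is convex, so comparing
the minimizer with points on the segment towards \<open>b\<close> gives, with \<open>u = bhat - b\<close>,
\<open>\<parallel>X bhat - f\<parallel>\<^sup>2 + \<parallel>X u\<parallel>\<^sup>2 \<le> \<parallel>X b - f\<parallel>\<^sup>2 + 2 \<langle>\<xi>, X u\<rangle> / n + 2 (|b|\<^sub>* - |bhat|\<^sub>*)\<close>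
(\<open>slope_basic_inequality\<close>). If \<open>b\<close> has at most \<open>s\<close> nonzero entries, the last difference is at
most \<open>h - t\<close>, where \<open>h\<close> and \<open>t\<close> are the parts of \<open>|u|\<^sub>*\<close> carried by the \<open>s\<close> largest and by the
remaining entries of \<open>u\<close> (\<open>sparse_sorted_l1_decrease\<close>). Suppose that the noise term is at most
\<open>max |u|\<^sub>* (\<Lambda> \<parallel>X u\<parallel> / \<theta>)\<close>, where \<open>\<Lambda>\<^sup>2\<close> is the sum of the first \<open>s\<close> squared weights. If \<open>|u|\<^sub>*\<close> is
the larger term, either the error terms have a nonpositive sum or \<open>u\<close> lies in the cone on which
\<open>\<theta> |u|\<^sub>2 \<le> \<parallel>X u\<parallel>\<close>; if it is the smaller one, \<open>|u|\<^sub>*\<close> is itself controlled by \<open>\<parallel>X u\<parallel>\<close>. In all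
remaining cases the error terms are at most a multiple of \<open>\<Lambda> \<parallel>X u\<parallel> / \<theta>\<close>, which is weighed against
\<open>\<parallel>X u\<parallel>\<^sup>2\<close>. This is done in \<open>slope_prediction_bound\<close> and
\<open>slope_estimation_bound\<close>.

It remains to bound the noise for all \<open>u\<close> at once, with probability \<open>1 - \<delta>/2\<close>. This is usually
done by Gaussian concentration around the median of a supremum. Here a PAC-Bayesian argument
replaces it. For a fixed vector \<open>y\<close> the variable \<open>exp (\<langle>y, \<zeta>\<rangle> - |y|\<^sup>2 / 2)\<close> has mean one when \<open>\<zeta>\<close> is
standard Gaussian. Average it over random \<open>y\<close>, each a sum of \<open>N\<close> independent atoms that are
multiples of columns of \<open>X\<close>. By Markov's inequality this single average is small with high
probability. By the Gibbs variational inequality its logarithm is at least the mean exponent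
under any other law of \<open>y\<close>, minus a relative entropy. For a given \<open>u\<close>, take a law whose mean is a
multiple of \<open>X u\<close> and which puts larger atoms on larger entries of \<open>u\<close>: then both the variance and
the entropy are of the order of \<open>\<Sum>\<^sub>k |u\<^sub>k| sqrt (log (2p/k))\<close>, which is the sorted norm
when \<open>|u\<^sub>1| \<ge> \<dots> \<ge> |u\<^sub>p|\<close>.
The resulting constant is \<open>5\<close>, and \<open>5 \<le> 4 + sqrt 2\<close> (\<open>gaussian_noise_bound\<close>).\<close>

section \<open>Decreasing rearrangements and the sorted norm\<close>

definition sorts_decreasing :: "(nat \<Rightarrow> 'p::finite) \<Rightarrow> ('p \<Rightarrow> real) \<Rightarrow> bool" where
  "sorts_decreasing \<phi> a \<longleftrightarrow> bij_betw \<phi> {1..CARD('p)} UNIV \<and>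
     (\<forall>k l. 1 \<le> k \<longrightarrow> k \<le> l \<longrightarrow> l \<le> CARD('p) \<longrightarrow> a (\<phi> l) \<le> a (\<phi> k))"

lemma ex_sorts_decreasing:
  fixes a :: "'p::finite \<Rightarrow> real"
  shows "\<exists>\<phi>. sorts_decreasing \<phi> a"
proof -
  obtain ys :: "'p list" where ys: "set ys = UNIV" "distinct ys"
    using finite_distinct_list[of "UNIV :: 'p set"] by auto
  define xs where "xs = sort_key (\<lambda>i. - a i) ys"
  have xs: "set xs = UNIV" "distinct xs" "length xs = CARD('p)"
    using ys distinct_card[of ys] by (auto simp: xs_def)
  have srt: "sorted (map (\<lambda>i. - a i) xs)"
    by (simp add: xs_def)
  have "bij_betw (\<lambda>k. k - 1) {1..CARD('p)} {..<CARD('p)}"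
    by (rule bij_betw_byWitness[where f' = Suc]) auto
  from bij_betw_trans[OF this bij_betw_nth[OF xs(2), of "{..<CARD('p)}" UNIV]]
  have "bij_betw (\<lambda>k. xs ! (k - 1)) {1..CARD('p)} UNIV"
    using xs by (simp add: comp_def)
  moreover have "a (xs ! (l - 1)) \<le> a (xs ! (k - 1))"
    if "1 \<le> k" "k \<le> l" "l \<le> CARD('p)" for k l
    using sorted_nth_mono[OF srt, of "k - 1" "l - 1"] that xs(3) by auto
  ultimately show ?thesis
    unfolding sorts_decreasing_def by blast
qed

text \<open>A sorted list is determined by its multiset of entries, so any ordering that happens to be
decreasing computes the rearrangement.\<close>

lemma sharp_eq_of_sorts_decreasing:
  fixes b :: "real ^ 'p"
  assumes \<phi>: "sorts_decreasing \<phi> (\<lambda>i. \<bar>b $ i\<bar>)" and k: "k \<in> {1..CARD('p)}"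
  shows "sharp b k = \<bar>b $ \<phi> k\<bar>"
proof -
  define xs where "xs = map (\<lambda>k. \<bar>b $ \<phi> k\<bar>) [1..<Suc CARD('p)]"
  have bij: "bij_betw \<phi> {1..CARD('p)} UNIV"
    and mono: "\<And>k l. 1 \<le> k \<Longrightarrow> k \<le> l \<Longrightarrow> l \<le> CARD('p) \<Longrightarrow> \<bar>b $ \<phi> l\<bar> \<le> \<bar>b $ \<phi> k\<bar>"
    using \<phi> unfolding sorts_decreasing_def by auto
  have "mset xs = image_mset (\<lambda>k. \<bar>b $ \<phi> k\<bar>) (mset_set {1..CARD('p)})"
    by (simp add: xs_def atLeastLessThanSuc_atLeastAtMost del: upt_Suc)
  also have "\<dots> = image_mset (\<lambda>i. \<bar>b $ i\<bar>) (image_mset \<phi> (mset_set {1..CARD('p)}))"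
    by (simp add: multiset.map_comp comp_def)
  also have "image_mset \<phi> (mset_set {1..CARD('p)}) = mset_set UNIV"
    using bij by (metis bij_betw_def image_mset_mset_set)
  finally have "image_mset (\<lambda>i. \<bar>b $ i\<bar>) (mset_set UNIV) = mset (rev xs)"
    by simp
  moreover have "sorted (rev xs)"
    unfolding sorted_rev_iff_nth_mono using mono by (auto simp: xs_def simp del: upt_Suc)
  ultimately have "rev (sorted_list_of_multiset (image_mset (\<lambda>i. \<bar>b $ i\<bar>) (mset_set UNIV))) = xs"
    by (simp only: sorted_list_of_multiset_mset sorted_sort_id rev_rev_ident)
  then show ?thesis
    using k by (auto simp: sharp_def xs_def nth_append simp del: upt_Suc)
qed

lemma sharp_decreasing:
  fixes b :: "real ^ 'p"
  assumes "1 \<le> k" "k \<le> l" "l \<le> CARD('p)"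
  shows "sharp b l \<le> sharp b k"
proof -
  obtain \<phi> where \<phi>: "sorts_decreasing \<phi> (\<lambda>i. \<bar>b $ i\<bar>)"
    using ex_sorts_decreasing[of "\<lambda>i. \<bar>b $ i\<bar>"] by blast
  show ?thesis
    using assms \<phi> sharp_eq_of_sorts_decreasing[OF \<phi>, of k] sharp_eq_of_sorts_decreasing[OF \<phi>, of l]
    by (auto simp: sorts_decreasing_def)
qed

lemma sharp_nonneg:
  fixes b :: "real ^ 'p"
  assumes "k \<in> {1..CARD('p)}"
  shows "sharp b k \<ge> 0"
  using ex_sorts_decreasing[of "\<lambda>i. \<bar>b $ i\<bar>"] sharp_eq_of_sorts_decreasing[OF _ assms, of _ b]
  by fastforce

lemma sum_sharp_squared:
  fixes b :: "real ^ 'p"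
  shows "(\<Sum>k=1..CARD('p). (sharp b k)\<^sup>2) = (norm b)\<^sup>2"
proof -
  obtain \<phi> where \<phi>: "sorts_decreasing \<phi> (\<lambda>i. \<bar>b $ i\<bar>)"
    using ex_sorts_decreasing[of "\<lambda>i. \<bar>b $ i\<bar>"] by blast
  then have bij: "bij_betw \<phi> {1..CARD('p)} UNIV"
    by (simp add: sorts_decreasing_def)
  have "(\<Sum>k=1..CARD('p). (sharp b k)\<^sup>2) = (\<Sum>k=1..CARD('p). (b $ \<phi> k)\<^sup>2)"
    by (intro sum.cong) (auto simp: sharp_eq_of_sorts_decreasing[OF \<phi>])
  also have "\<dots> = (\<Sum>i\<in>UNIV. (b $ i)\<^sup>2)"
    using bij by (rule sum.reindex_bij_betw)
  also have "\<dots> = (norm b)\<^sup>2"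
    unfolding power2_norm_eq_inner inner_vec_def by (simp add: power2_eq_square)
  finally show ?thesis .
qed

definition decreasing_weights :: "nat \<Rightarrow> (nat \<Rightarrow> real) \<Rightarrow> bool" where
  "decreasing_weights p lam \<longleftrightarrow>
     (\<forall>k\<in>{1..p}. 0 \<le> lam k) \<and> (\<forall>k. 1 \<le> k \<longrightarrow> k < p \<longrightarrow> lam (Suc k) \<le> lam k)"

text \<open>Decreasing weights are nonnegative combinations of indicators of initial segments, so it is
enough to control the partial sums.\<close>

lemma abel_sum_nonneg:
  fixes lam d :: "nat \<Rightarrow> real"
  assumes lam: "decreasing_weights p lam"
    and d: "\<And>m. m \<le> p \<Longrightarrow> (\<Sum>k=1..m. d k) \<ge> 0"
  shows "(\<Sum>k=1..p. lam k * d k) \<ge> 0"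
proof (cases "p = 0")
  case False
  (* The weight of the last index bounds the whole sum from below; this form is inductive. *)
  have "(\<Sum>k=1..m. lam k * d k) \<ge> lam m * (\<Sum>k=1..m. d k)" if "1 \<le> m" "m \<le> p" for m
    using that
  proof (induction m rule: nat_induct_at_least)
    case base
    then show ?case by simp
  next
    case (Suc m)
    have "lam (Suc m) * (\<Sum>k=1..Suc m. d k)
        = lam (Suc m) * (\<Sum>k=1..m. d k) + lam (Suc m) * d (Suc m)"
      by (simp add: distrib_left)
    also have "\<dots> \<le> lam m * (\<Sum>k=1..m. d k) + lam (Suc m) * d (Suc m)"
      using Suc lam d[of m]
      by (intro add_right_mono mult_right_mono) (auto simp: decreasing_weights_def)
    also have "\<dots> \<le> (\<Sum>k=1..Suc m. lam k * d k)"
      using Suc by simp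
    finally show ?case .
  qed
  then have "lam p * (\<Sum>k=1..p. d k) \<le> (\<Sum>k=1..p. lam k * d k)"
    using False by simp
  moreover have "0 \<le> lam p * (\<Sum>k=1..p. d k)"
    using False lam d[of p] by (intro mult_nonneg_nonneg) (auto simp: decreasing_weights_def)
  ultimately show ?thesis by linarith
qed simp

text \<open>Exchange argument: the elements of \<open>T\<close> outside the top \<open>card T\<close> indices are as many as the top
indices missing from \<open>T\<close>, and the entry in position \<open>card T\<close> separates the two groups.\<close>

lemma sum_le_top_sum:
  fixes b :: "real ^ 'p"
  assumes T: "card T \<le> CARD('p)"
  shows "(\<Sum>i\<in>T. \<bar>b $ i\<bar>) \<le> (\<Sum>k=1..card T. sharp b k)"
proof (cases "T = {}")
  case False
  obtain \<phi> where \<phi>: "sorts_decreasing \<phi> (\<lambda>i. \<bar>b $ i\<bar>)"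
    using ex_sorts_decreasing[of "\<lambda>i. \<bar>b $ i\<bar>"] by blast
  have bij: "bij_betw \<phi> {1..CARD('p)} UNIV"
    and mono: "\<And>k l. 1 \<le> k \<Longrightarrow> k \<le> l \<Longrightarrow> l \<le> CARD('p) \<Longrightarrow> \<bar>b $ \<phi> l\<bar> \<le> \<bar>b $ \<phi> k\<bar>"
    using \<phi> unfolding sorts_decreasing_def by auto
  define m where "m = card T"
  have m: "1 \<le> m" "m \<le> CARD('p)"
    using False T by (auto simp: m_def card_gt_0_iff Suc_le_eq)
  define S where "S = \<phi> ` {1..m}"
  have inj: "inj_on \<phi> {1..m}"
    using bij m by (auto simp: bij_betw_def intro: inj_on_subset)
  have cards: "card (T - S) = card (S - T)"
  proof -
    have "card S = card T" using inj by (simp add: S_def card_image m_def)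
    then show ?thesis
      by (metis card_Diff_subset_Int finite Int_commute)
  qed
  define t where "t = \<bar>b $ \<phi> m\<bar>"
  have "(\<Sum>i\<in>T - S. \<bar>b $ i\<bar>) \<le> real (card (T - S)) * t"
  proof (rule sum_bounded_above)
    fix i assume i: "i \<in> T - S"
    obtain k where k: "k \<in> {1..CARD('p)}" "\<phi> k = i"
      using bij by (metis UNIV_I bij_betw_def imageE)
    then have "k > m" using i by (force simp: S_def)
    then show "\<bar>b $ i\<bar> \<le> t"
      using k m mono[of m k] by (simp add: t_def)
  qed
  also have "\<dots> \<le> (\<Sum>i\<in>S - T. \<bar>b $ i\<bar>)"
    unfolding cards by (rule sum_bounded_below) (use m mono in \<open>auto simp: S_def t_def\<close>)
  finally have "(\<Sum>i\<in>T. \<bar>b $ i\<bar>) \<le> (\<Sum>i\<in>S. \<bar>b $ i\<bar>)"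
    using sum.Int_Diff[of T "\<lambda>i. \<bar>b $ i\<bar>" S] sum.Int_Diff[of S "\<lambda>i. \<bar>b $ i\<bar>" T]
    by (simp add: Int_commute)
  also have "\<dots> = (\<Sum>k=1..m. \<bar>b $ \<phi> k\<bar>)"
    using inj by (simp add: S_def sum.reindex)
  also have "\<dots> = (\<Sum>k=1..m. sharp b k)"
    using m by (intro sum.cong) (auto simp: sharp_eq_of_sorts_decreasing[OF \<phi>])
  finally show ?thesis by (simp add: m_def)
qed simp

text \<open>The sorted norm is the maximum of the weighted \<open>l\<^sub>1\<close> norms over all orderings of the entries.
Convexity and the comparison for sparse vectors both follow by choosing the ordering
well.\<close>

lemma rearrangement_le_sorted_l1:
  fixes b :: "real ^ 'p"
  assumes lam: "decreasing_weights CARD('p) lam"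
    and \<psi>: "bij_betw \<psi> {1..CARD('p)} UNIV"
  shows "(\<Sum>k=1..CARD('p). lam k * \<bar>b $ \<psi> k\<bar>) \<le> sorted_l1 lam b"
proof -
  have "0 \<le> (\<Sum>k=1..CARD('p). lam k * (sharp b k - \<bar>b $ \<psi> k\<bar>))"
  proof (rule abel_sum_nonneg[OF lam])
    fix m assume m: "m \<le> CARD('p)"
    then have inj: "inj_on \<psi> {1..m}"
      using \<psi> by (auto simp: bij_betw_def intro: inj_on_subset)
    then have "card (\<psi> ` {1..m}) = m" by (simp add: card_image)
    then show "0 \<le> (\<Sum>k=1..m. sharp b k - \<bar>b $ \<psi> k\<bar>)"
      using sum_le_top_sum[of "\<psi> ` {1..m}" b] inj m by (simp add: sum.reindex sum_subtractf)
  qed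
  then show ?thesis
    by (simp add: sorted_l1_def right_diff_distrib sum_subtractf)
qed

lemma sorted_l1_eq_of_sorts_decreasing:
  fixes b :: "real ^ 'p"
  assumes "sorts_decreasing \<phi> (\<lambda>i. \<bar>b $ i\<bar>)"
  shows "sorted_l1 lam b = (\<Sum>k=1..CARD('p). lam k * \<bar>b $ \<phi> k\<bar>)"
  unfolding sorted_l1_def by (intro sum.cong) (auto simp: sharp_eq_of_sorts_decreasing[OF assms])

lemma sorted_l1_convex_combination:
  fixes a b :: "real ^ 'p"
  assumes lam: "decreasing_weights CARD('p) lam"
    and "\<alpha> \<ge> 0" "\<beta> \<ge> 0"
  shows "sorted_l1 lam (\<alpha> *\<^sub>R a + \<beta> *\<^sub>R b) \<le> \<alpha> * sorted_l1 lam a + \<beta> * sorted_l1 lam b"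
proof -
  obtain \<phi> where \<phi>: "sorts_decreasing \<phi> (\<lambda>i. \<bar>(\<alpha> *\<^sub>R a + \<beta> *\<^sub>R b) $ i\<bar>)"
    using ex_sorts_decreasing[of "\<lambda>i. \<bar>(\<alpha> *\<^sub>R a + \<beta> *\<^sub>R b) $ i\<bar>"] by blast
  then have bij: "bij_betw \<phi> {1..CARD('p)} UNIV"
    by (simp add: sorts_decreasing_def)
  have "sorted_l1 lam (\<alpha> *\<^sub>R a + \<beta> *\<^sub>R b)
      = (\<Sum>k=1..CARD('p). lam k * \<bar>\<alpha> * a $ \<phi> k + \<beta> * b $ \<phi> k\<bar>)"
    using sorted_l1_eq_of_sorts_decreasing[OF \<phi>] by simp
  also have "\<dots> \<le> (\<Sum>k=1..CARD('p). \<alpha> * (lam k * \<bar>a $ \<phi> k\<bar>) + \<beta> * (lam k * \<bar>b $ \<phi> k\<bar>))"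
  proof (rule sum_mono)
    fix k assume k: "k \<in> {1..CARD('p)}"
    have "\<bar>\<alpha> * a $ \<phi> k + \<beta> * b $ \<phi> k\<bar> \<le> \<alpha> * \<bar>a $ \<phi> k\<bar> + \<beta> * \<bar>b $ \<phi> k\<bar>"
      using assms(2,3) by (metis abs_mult abs_of_nonneg abs_triangle_ineq)
    from mult_left_mono[OF this, of "lam k"] lam k
    show "lam k * \<bar>\<alpha> * a $ \<phi> k + \<beta> * b $ \<phi> k\<bar>
        \<le> \<alpha> * (lam k * \<bar>a $ \<phi> k\<bar>) + \<beta> * (lam k * \<bar>b $ \<phi> k\<bar>)"
      by (simp add: algebra_simps decreasing_weights_def)
  qed
  also have "\<dots> = \<alpha> * (\<Sum>k=1..CARD('p). lam k * \<bar>a $ \<phi> k\<bar>)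
      + \<beta> * (\<Sum>k=1..CARD('p). lam k * \<bar>b $ \<phi> k\<bar>)"
    by (simp add: sum.distrib sum_distrib_left)
  also have "\<dots> \<le> \<alpha> * sorted_l1 lam a + \<beta> * sorted_l1 lam b"
    using rearrangement_le_sorted_l1[OF lam bij] assms(2,3)
    by (intro add_mono mult_left_mono) auto
  finally show ?thesis .
qed

text \<open>An ordering that sorts \<open>b\<close> computes \<open>|b|\<^sub>*\<close> exactly and bounds \<open>|b + u|\<^sub>*\<close> from below. Since \<open>b\<close>
vanishes beyond position \<open>s\<close>, the order of the remaining positions is still free, and sorting them
by the size of \<open>u\<close> makes the gain there at least the tail of \<open>|u|\<^sub>*\<close>.\<close>

lemma sparse_sorted_l1_decrease:
  fixes b u :: "real ^ 'p"
  assumes lam: "decreasing_weights CARD('p) lam"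
    and s: "s \<le> CARD('p)" "l0 b \<le> s"
  shows "sorted_l1 lam b - sorted_l1 lam (b + u)
           \<le> (\<Sum>k=1..s. lam k * sharp u k) - (\<Sum>k=Suc s..CARD('p). lam k * sharp u k)"
proof -
  let ?p = "CARD('p)"
  obtain S where S: "{i. b $ i \<noteq> 0} \<subseteq> S" "card S = s"
    using s exists_subset_between[of "{i. b $ i \<noteq> 0}" s UNIV] by (auto simp: l0_def)
  define B where "B = (\<Sum>i\<in>UNIV. \<bar>u $ i\<bar>)"
  have uB: "\<bar>u $ i\<bar> \<le> B" for i
    unfolding B_def by (rule member_le_sum) auto
  (* Sorting by t puts S first, ordered by b, and then the complement of S, ordered by u; the
     offset B + 1 separates the two blocks. *)
  define t where "t i = (if i \<in> S then B + 1 + \<bar>b $ i\<bar> else \<bar>u $ i\<bar>)" for i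
  obtain \<phi> where \<phi>: "sorts_decreasing \<phi> t"
    using ex_sorts_decreasing[of "t"] by blast
  have bij: "bij_betw \<phi> {1..?p} UNIV"
    and mono: "\<And>k l. 1 \<le> k \<Longrightarrow> k \<le> l \<Longrightarrow> l \<le> ?p \<Longrightarrow> t (\<phi> l) \<le> t (\<phi> k)"
    using \<phi> unfolding sorts_decreasing_def by auto
  have lt: "t j < t i" if "i \<in> S" "j \<notin> S" for i j
    using that uB[of j] by (simp add: t_def)
  have inj: "inj_on \<phi> {1..?p}"
    using bij by (simp add: bij_betw_def)
  have down: "\<phi> k \<in> S" if "1 \<le> k" "k \<le> l" "l \<le> ?p" "\<phi> l \<in> S" for k l
    using lt[of "\<phi> l" "\<phi> k"] mono[OF that(1-3)] that(4) by (meson linorder_not_less)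
  have S_iff: "\<phi> k \<in> S \<longleftrightarrow> k \<le> s" if k: "k \<in> {1..?p}" for k
  proof -
    define K where "K = {k \<in> {1..?p}. \<phi> k \<in> S}"
    have "\<phi> ` K = S"
    proof -
      have "\<phi> ` K = \<phi> ` {1..?p} \<inter> S" unfolding K_def by blast
      then show ?thesis using bij by (simp add: bij_betw_def)
    qed
    then have cK: "card K = s"
      using S(2) inj by (metis (no_types, lifting) K_def card_image inj_on_subset mem_Collect_eq subsetI)
    have fK: "finite K" by (simp add: K_def)
    show ?thesis
    proof
      assume "\<phi> k \<in> S"
      then have "{1..k} \<subseteq> K"
        using k down by (auto simp: K_def)
      then show "k \<le> s" using card_mono[OF fK, of "{1..k}"] cK by simp
    next
      assume "k \<le> s"
      show "\<phi> k \<in> S"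
      proof (rule ccontr)
        assume "\<phi> k \<notin> S"
        then have "K \<subseteq> {1..<k}"
          using k down by (auto simp: K_def) (meson leI)
        then have "s \<le> k - 1" using card_mono[of "{1..<k}" K] cK by simp
        then show False using \<open>k \<le> s\<close> k by auto
      qed
    qed
  qed
  have b_sorted: "sorts_decreasing \<phi> (\<lambda>i. \<bar>b $ i\<bar>)"
    unfolding sorts_decreasing_def
  proof (intro conjI bij allI impI)
    fix k l assume kl: "1 \<le> k" "k \<le> l" "l \<le> ?p"
    show "\<bar>b $ \<phi> l\<bar> \<le> \<bar>b $ \<phi> k\<bar>"
    proof (cases "\<phi> l \<in> S")
      case True
      then show ?thesis using mono[OF kl] down[OF kl] by (simp add: t_def)
    next
      case False
      then have "b $ \<phi> l = 0" using S(1) by auto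
      then show ?thesis by simp
    qed
  qed
  have split: "(\<Sum>k=1..?p. f k) = (\<Sum>k=1..s. f k) + (\<Sum>k=Suc s..?p. f k)" for f :: "nat \<Rightarrow> real"
  proof -
    have "{1..?p} = {1..s} \<union> {Suc s..?p}" using s(1) by auto
    then show ?thesis by (simp add: sum.union_disjoint)
  qed
  have head: "(\<Sum>k=1..s. lam k * \<bar>u $ \<phi> k\<bar>) \<le> (\<Sum>k=1..s. lam k * sharp u k)"
  proof -
    (* The truncated weights are still decreasing, so the rearrangement bound applies to them. *)
    define lam' where "lam' k = (if k \<le> s then lam k else 0)" for k
    have "(\<Sum>k=1..?p. lam' k * \<bar>u $ \<phi> k\<bar>) \<le> sorted_l1 lam' u"
      using lam by (intro rearrangement_le_sorted_l1 bij) (auto simp: lam'_def decreasing_weights_def)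
    then show ?thesis
      unfolding sorted_l1_def split by (simp add: lam'_def)
  qed
  have tail: "sharp u k \<le> \<bar>u $ \<phi> k\<bar>" if k: "k \<in> {Suc s..?p}" for k
  proof -
    obtain \<psi> where \<psi>: "sorts_decreasing \<psi> (\<lambda>i. \<bar>u $ i\<bar>)"
      using ex_sorts_decreasing[of "\<lambda>i. \<bar>u $ i\<bar>"] by blast
    have bij': "bij_betw \<psi> {1..?p} UNIV"
      using \<psi> by (simp add: sorts_decreasing_def)
    have k': "k \<in> {1..?p}" using k by auto
    (* Pigeonhole: the k largest entries of u and the positions k..p of the other ordering are
       k + (p - k + 1) > p indices in total, so they share one. *)
    have "\<psi> ` {1..k} \<inter> \<phi> ` {k..?p} \<noteq> {}"
    proof
      assume "\<psi> ` {1..k} \<inter> \<phi> ` {k..?p} = {}"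
      then have "card (\<psi> ` {1..k} \<union> \<phi> ` {k..?p}) = card (\<psi> ` {1..k}) + card (\<phi> ` {k..?p})"
        by (intro card_Un_disjoint) auto
      also have "\<dots> = k + (Suc ?p - k)"
        using inj bij' k' by (subst (1 2) card_image) (auto simp: bij_betw_def intro: inj_on_subset)
      also have "\<dots> > ?p" using k' by simp
      finally show False
        using card_mono[of "UNIV :: 'p set" "\<psi> ` {1..k} \<union> \<phi> ` {k..?p}"] by simp
    qed
    then obtain z where "z \<in> \<psi> ` {1..k}" "z \<in> \<phi> ` {k..?p}"
      by blast
    then obtain i j where ij: "1 \<le> i" "i \<le> k" "k \<le> j" "j \<le> ?p" "\<psi> i = \<phi> j"
      by (elim imageE) auto
    have "sharp u k \<le> sharp u i"
      using ij k' by (intro sharp_decreasing) auto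
    also have "\<dots> = \<bar>u $ \<phi> j\<bar>"
      using ij by (subst sharp_eq_of_sorts_decreasing[OF \<psi>]) auto
    also have "\<dots> \<le> \<bar>u $ \<phi> k\<bar>"
      using mono[of k j] ij k k' S_iff[of k] S_iff[of j] by (auto simp: t_def)
    finally show ?thesis .
  qed
  have zero: "b $ \<phi> k = 0" if "k \<in> {Suc s..?p}" for k
    using that S_iff[of k] S(1) by auto
  have "sorted_l1 lam b - sorted_l1 lam (b + u)
      \<le> (\<Sum>k=1..?p. lam k * \<bar>b $ \<phi> k\<bar>) - (\<Sum>k=1..?p. lam k * \<bar>(b + u) $ \<phi> k\<bar>)"
    using rearrangement_le_sorted_l1[OF lam bij, of "b + u"]
    by (simp add: sorted_l1_eq_of_sorts_decreasing[OF b_sorted])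
  also have "\<dots> = (\<Sum>k=1..s. lam k * (\<bar>b $ \<phi> k\<bar> - \<bar>(b + u) $ \<phi> k\<bar>))
      + (\<Sum>k=Suc s..?p. lam k * (\<bar>b $ \<phi> k\<bar> - \<bar>(b + u) $ \<phi> k\<bar>))"
    unfolding split by (simp add: sum_subtractf right_diff_distrib)
  also have "\<dots> \<le> (\<Sum>k=1..s. lam k * \<bar>u $ \<phi> k\<bar>) + (\<Sum>k=Suc s..?p. - (lam k * sharp u k))"
  proof (intro add_mono sum_mono)
    fix k assume "k \<in> {1..s}"
    then show "lam k * (\<bar>b $ \<phi> k\<bar> - \<bar>(b + u) $ \<phi> k\<bar>) \<le> lam k * \<bar>u $ \<phi> k\<bar>"
      using lam s(1) by (intro mult_left_mono) (auto simp: decreasing_weights_def)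
  next
    fix k assume k: "k \<in> {Suc s..?p}"
    then show "lam k * (\<bar>b $ \<phi> k\<bar> - \<bar>(b + u) $ \<phi> k\<bar>) \<le> - (lam k * sharp u k)"
      using mult_left_mono[OF tail[OF k], of "lam k"] zero[OF k] lam
      by (simp add: decreasing_weights_def)
  qed
  also have "\<dots> \<le> (\<Sum>k=1..s. lam k * sharp u k) - (\<Sum>k=Suc s..?p. lam k * sharp u k)"
    using head by (simp add: sum_negf)
  finally show ?thesis .
qed

section \<open>Exponential moments of a Gaussian vector\<close>

lemma nn_integral_normal_density_exp:
  fixes \<sigma> t :: real
  assumes "\<sigma> > 0"
  shows "(\<integral>\<^sup>+x. ennreal (normal_density 0 \<sigma> x) * ennreal (exp (t * x)) \<partial>lborel)
           = ennreal (exp (\<sigma>\<^sup>2 * t\<^sup>2 / 2))"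
proof -
  (* Completing the square: tilting a centred normal density shifts its mean. *)
  have shift: "normal_density 0 \<sigma> x * exp (t * x)
      = exp (\<sigma>\<^sup>2 * t\<^sup>2 / 2) * normal_density (\<sigma>\<^sup>2 * t) \<sigma> x" for x
  proof -
    have "- (x - 0)\<^sup>2 / (2 * \<sigma>\<^sup>2) + t * x = \<sigma>\<^sup>2 * t\<^sup>2 / 2 + - (x - \<sigma>\<^sup>2 * t)\<^sup>2 / (2 * \<sigma>\<^sup>2)"
      using assms by (simp add: field_simps power2_eq_square)
    then have "exp (- (x - 0)\<^sup>2 / (2 * \<sigma>\<^sup>2)) * exp (t * x)
        = exp (\<sigma>\<^sup>2 * t\<^sup>2 / 2) * exp (- (x - \<sigma>\<^sup>2 * t)\<^sup>2 / (2 * \<sigma>\<^sup>2))"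
      by (metis exp_add)
    then show ?thesis
      unfolding normal_density_def by (simp add: mult_ac)
  qed
  have one: "(\<integral>\<^sup>+x. ennreal (normal_density (\<sigma>\<^sup>2 * t) \<sigma> x) \<partial>lborel) = 1"
    using prob_space.emeasure_space_1[OF prob_space_normal_density[OF assms, of "\<sigma>\<^sup>2 * t"]]
    by (simp add: emeasure_density)
  have "(\<integral>\<^sup>+x. ennreal (normal_density 0 \<sigma> x) * ennreal (exp (t * x)) \<partial>lborel)
      = (\<integral>\<^sup>+x. ennreal (exp (\<sigma>\<^sup>2 * t\<^sup>2 / 2)) * ennreal (normal_density (\<sigma>\<^sup>2 * t) \<sigma> x) \<partial>lborel)"
    by (intro nn_integral_cong) (simp add: shift flip: ennreal_mult)
  also have "\<dots> = ennreal (exp (\<sigma>\<^sup>2 * t\<^sup>2 / 2))"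
    by (simp add: nn_integral_cmult one)
  finally show ?thesis .
qed

lemma isotropic_normal_measurable:
  assumes "isotropic_normal M \<sigma> \<xi>"
  shows "\<xi> \<in> borel_measurable M"
proof -
  have "(\<lambda>\<omega>. \<xi> \<omega> $ i) \<in> borel_measurable M" for i
    using assms distributed_measurable unfolding isotropic_normal_def by fastforce
  then have "(\<lambda>\<omega>. \<Sum>i\<in>UNIV. (\<xi> \<omega> $ i) *\<^sub>R (axis i 1 :: real ^ 'b)) \<in> borel_measurable M"
    by measurable
  moreover have "(\<Sum>i\<in>UNIV. (\<xi> \<omega> $ i) *\<^sub>R (axis i 1 :: real ^ 'b)) = \<xi> \<omega>" for \<omega>
    by (simp add: vec_eq_iff axis_def if_distrib cong: if_cong)
  ultimately show ?thesis by simp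
qed

text \<open>The normalization makes the mean equal to one for every direction and length of \<open>y\<close>; mixtures
of these variables over \<open>y\<close> inherit this.\<close>

lemma isotropic_normal_exp_moment:
  fixes \<xi> :: "'w \<Rightarrow> real ^ 'n" and y :: "real ^ 'n"
  assumes "prob_space M" and \<sigma>: "\<sigma> > 0" and \<xi>: "isotropic_normal M \<sigma> \<xi>"
  shows "(\<integral>\<^sup>+\<omega>. ennreal (exp (y \<bullet> ((1 / \<sigma>) *\<^sub>R \<xi> \<omega>) - (norm y)\<^sup>2 / 2)) \<partial>M) = 1"
proof -
  interpret prob_space M by fact
  define Y where "Y = (\<lambda>i x. ennreal (exp (y $ i / \<sigma> * x)))"
  have indep: "indep_vars (\<lambda>_. borel) (\<lambda>i \<omega>. \<xi> \<omega> $ i) UNIV"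
    and distr: "\<And>i. distributed M lborel (\<lambda>\<omega>. \<xi> \<omega> $ i) (\<lambda>x. ennreal (normal_density 0 \<sigma> x))"
    using \<xi> unfolding isotropic_normal_def by auto
  have norm_y: "(norm y)\<^sup>2 = (\<Sum>i\<in>UNIV. (y $ i)\<^sup>2)"
    unfolding power2_norm_eq_inner inner_vec_def by (simp add: power2_eq_square)
  have "(\<integral>\<^sup>+\<omega>. ennreal (exp (y \<bullet> ((1 / \<sigma>) *\<^sub>R \<xi> \<omega>) - (norm y)\<^sup>2 / 2)) \<partial>M)
      = (\<integral>\<^sup>+\<omega>. ennreal (exp (- (norm y)\<^sup>2 / 2)) * (\<Prod>i\<in>UNIV. Y i (\<xi> \<omega> $ i)) \<partial>M)"
  proof (intro nn_integral_cong)
    fix \<omega>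
    have "y \<bullet> ((1 / \<sigma>) *\<^sub>R \<xi> \<omega>) = (\<Sum>i\<in>UNIV. y $ i / \<sigma> * \<xi> \<omega> $ i)"
      by (simp add: inner_vec_def sum_distrib_left mult_ac)
    then show "ennreal (exp (y \<bullet> ((1 / \<sigma>) *\<^sub>R \<xi> \<omega>) - (norm y)\<^sup>2 / 2))
        = ennreal (exp (- (norm y)\<^sup>2 / 2)) * (\<Prod>i\<in>UNIV. Y i (\<xi> \<omega> $ i))"
      unfolding Y_def
      by (simp add: prod_ennreal exp_sum[symmetric] flip: ennreal_mult exp_add)
  qed
  also have "\<dots> = ennreal (exp (- (norm y)\<^sup>2 / 2))
      * (\<integral>\<^sup>+\<omega>. (\<Prod>i\<in>UNIV. Y i (\<xi> \<omega> $ i)) \<partial>M)"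
  proof (rule nn_integral_cmult)
    have "(\<lambda>\<omega>. \<xi> \<omega> $ i) \<in> borel_measurable M" for i
      using indep by (auto simp: indep_vars_def)
    then show "(\<lambda>\<omega>. \<Prod>i\<in>UNIV. Y i (\<xi> \<omega> $ i)) \<in> borel_measurable M"
      unfolding Y_def by measurable
  qed
  also have "(\<integral>\<^sup>+\<omega>. (\<Prod>i\<in>UNIV. Y i (\<xi> \<omega> $ i)) \<partial>M) = (\<Prod>i\<in>UNIV. \<integral>\<^sup>+\<omega>. Y i (\<xi> \<omega> $ i) \<partial>M)"
    by (intro indep_vars_nn_integral indep_vars_compose2[OF indep]) (auto simp: Y_def)
  also have "\<dots> = (\<Prod>i\<in>UNIV. ennreal (exp ((y $ i)\<^sup>2 / 2)))"
  proof (intro prod.cong refl)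
    fix i
    have "(\<integral>\<^sup>+\<omega>. Y i (\<xi> \<omega> $ i) \<partial>M)
        = (\<integral>\<^sup>+x. ennreal (normal_density 0 \<sigma> x) * ennreal (exp (y $ i / \<sigma> * x)) \<partial>lborel)"
      by (subst distributed_nn_integral[OF distr[of i], symmetric]) (auto simp: Y_def)
    also have "\<dots> = ennreal (exp ((y $ i)\<^sup>2 / 2))"
      using \<sigma> by (subst nn_integral_normal_density_exp) (auto simp: power_divide)
    finally show "(\<integral>\<^sup>+\<omega>. Y i (\<xi> \<omega> $ i) \<partial>M) = ennreal (exp ((y $ i)\<^sup>2 / 2))" .
  qed
  also have "\<dots> = ennreal (exp ((norm y)\<^sup>2 / 2))"
    by (simp add: prod_ennreal exp_sum[symmetric] norm_y sum_divide_distrib)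
  finally show ?thesis
    by (simp flip: ennreal_mult exp_add)
qed

section \<open>A PAC-Bayesian bound for sums of random atoms\<close>

text \<open>The sum of \<open>exp (Y \<bullet> z - |Y|\<^sup>2 / 2)\<close> over all \<open>Y = y + v a\<^sub>1 + \<dots> + v a\<^sub>N\<close> with \<open>a\<^sub>i \<in> I\<close>, weighted by
\<open>\<nu> a\<^sub>1 \<dots> \<nu> a\<^sub>N\<close>. The recursion on \<open>N\<close>, with the partial sum as an argument, turns the product
structure into one-step statements. The measure \<open>\<nu>\<close> is not normalized.\<close>

fun atom_mixture ::
    "('a \<Rightarrow> real) \<Rightarrow> ('a \<Rightarrow> real ^ 'n) \<Rightarrow> 'a set \<Rightarrow> nat \<Rightarrow> real ^ 'n \<Rightarrow> real ^ 'n \<Rightarrow> real" where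
  "atom_mixture \<nu> v I 0 y z = exp (y \<bullet> z - (norm y)\<^sup>2 / 2)"
| "atom_mixture \<nu> v I (Suc N) y z = (\<Sum>a\<in>I. \<nu> a * atom_mixture \<nu> v I N (y + v a) z)"

lemma atom_mixture_pos:
  assumes "finite I" "I \<noteq> {}" "\<And>a. a \<in> I \<Longrightarrow> \<nu> a > 0"
  shows "atom_mixture \<nu> v I N y z > 0"
  using assms by (induction N arbitrary: y) (auto intro!: sum_pos)

lemma atom_mixture_measurable:
  "(\<lambda>z. atom_mixture \<nu> v I N y z) \<in> borel_measurable borel"
proof (induction N arbitrary: y)
  case 0
  have "(\<lambda>z. exp (y \<bullet> z - (norm y)\<^sup>2 / 2)) \<in> borel_measurable borel"
    by measurable
  then show ?case by simp
next
  case (Suc N)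
  have "(\<lambda>z. \<Sum>a\<in>I. \<nu> a * atom_mixture \<nu> v I N (y + v a) z) \<in> borel_measurable borel"
    by (intro borel_measurable_sum borel_measurable_times borel_measurable_const Suc)
  then show ?case by simp
qed

lemma atom_mixture_expectation:
  fixes \<zeta> :: "'w \<Rightarrow> real ^ 'n"
  assumes I: "finite I" "I \<noteq> {}" and \<nu>: "\<And>a. a \<in> I \<Longrightarrow> \<nu> a > 0"
    and \<zeta>: "\<zeta> \<in> borel_measurable M"
    and mom: "\<And>y. (\<integral>\<^sup>+\<omega>. ennreal (exp (y \<bullet> \<zeta> \<omega> - (norm y)\<^sup>2 / 2)) \<partial>M) = 1"
  shows "(\<integral>\<^sup>+\<omega>. ennreal (atom_mixture \<nu> v I N y (\<zeta> \<omega>)) \<partial>M) = ennreal ((\<Sum>a\<in>I. \<nu> a) ^ N)"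
proof (induction N arbitrary: y)
  case 0
  then show ?case by (simp add: mom)
next
  case (Suc N)
  note [measurable] = \<zeta> measurable_compose[OF \<zeta> atom_mixture_measurable]
  have pos: "atom_mixture \<nu> v I N y z > 0" for y z
    using I \<nu> by (rule atom_mixture_pos)
  have "(\<integral>\<^sup>+\<omega>. ennreal (atom_mixture \<nu> v I (Suc N) y (\<zeta> \<omega>)) \<partial>M)
      = (\<integral>\<^sup>+\<omega>. (\<Sum>a\<in>I. ennreal (\<nu> a) * ennreal (atom_mixture \<nu> v I N (y + v a) (\<zeta> \<omega>))) \<partial>M)"
    using \<nu> pos
    by (intro nn_integral_cong) (auto simp: less_imp_le simp flip: ennreal_mult sum_ennreal)
  also have "\<dots> = (\<Sum>a\<in>I. ennreal (\<nu> a) * ennreal ((\<Sum>a\<in>I. \<nu> a) ^ N))"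
    by (simp add: nn_integral_sum nn_integral_cmult Suc)
  also have "\<dots> = ennreal ((\<Sum>a\<in>I. \<nu> a) ^ Suc N)"
    using \<nu> by (simp add: sum_nonneg less_imp_le sum_distrib_right flip: ennreal_mult)
  finally show ?case .
qed

text \<open>The Gibbs variational inequality; it amounts to \<open>ln x \<le> x - 1\<close> with \<open>x\<close> the ratio of the Gibbs
weight \<open>\<nu> a * y a / T\<close> to \<open>\<rho> a\<close>.\<close>

lemma Donsker_Varadhan_finite:
  fixes \<rho> \<nu> y :: "'a \<Rightarrow> real"
  assumes "finite J" and \<rho>: "\<And>a. a \<in> J \<Longrightarrow> \<rho> a \<ge> 0" "(\<Sum>a\<in>J. \<rho> a) = 1"
    and \<nu>: "\<And>a. a \<in> J \<Longrightarrow> \<nu> a > 0" and y: "\<And>a. a \<in> J \<Longrightarrow> y a > 0"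
  shows "(\<Sum>a\<in>J. \<rho> a * (ln (y a) - ln (\<rho> a / \<nu> a))) \<le> ln (\<Sum>a\<in>J. \<nu> a * y a)"
proof -
  define T where "T = (\<Sum>a\<in>J. \<nu> a * y a)"
  have "J \<noteq> {}" using \<rho>(2) by auto
  then have T: "T > 0"
    unfolding T_def using assms by (intro sum_pos) auto
  have "\<rho> a * (ln (y a) - ln (\<rho> a / \<nu> a) - ln T) \<le> \<nu> a * y a / T - \<rho> a" if a: "a \<in> J" for a
  proof (cases "\<rho> a = 0")
    case True
    then show ?thesis using T \<nu>[OF a] y[OF a] by simp
  next
    case False
    then have pos: "\<rho> a > 0" "\<nu> a > 0" "y a > 0"
      using \<rho>(1)[OF a] \<nu>[OF a] y[OF a] by auto
    then have "ln (y a) - ln (\<rho> a / \<nu> a) - ln T = ln (\<nu> a * y a / (T * \<rho> a))"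
      using T by (simp add: ln_div ln_mult)
    also have "\<dots> \<le> \<nu> a * y a / (T * \<rho> a) - 1"
      using T pos by (intro ln_le_minus_one) simp
    finally show ?thesis
      using pos T by (simp add: field_simps)
  qed
  then have "(\<Sum>a\<in>J. \<rho> a * (ln (y a) - ln (\<rho> a / \<nu> a) - ln T)) \<le> (\<Sum>a\<in>J. \<nu> a * y a / T - \<rho> a)"
    by (intro sum_mono)
  also have "\<dots> = 0"
    using T \<rho>(2) by (simp add: sum_subtractf T_def flip: sum_divide_distrib)
  finally show ?thesis
    using \<rho>(2) by (simp add: right_diff_distrib sum_subtractf T_def flip: sum_distrib_right)
qed

text \<open>The bound holds for every probability \<open>\<rho>\<close> on the atoms, while the mixture does not depend on \<open>\<rho>\<close>:
this is what makes the noise bound uniform. If the atoms are drawn from \<open>\<rho>\<close>, the sum has mean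
\<open>y + N w\<close>, its mean squared length exceeds that of the mean by at most \<open>N\<close> second moments, and each
draw costs one relative entropy. Only the atoms in \<open>J\<close> are charged by \<open>\<rho>\<close>.\<close>

lemma atom_mixture_lower_bound:
  fixes v :: "'a \<Rightarrow> real ^ 'n"
  assumes I: "finite I" and J: "J \<subseteq> I" and \<nu>: "\<And>a. a \<in> I \<Longrightarrow> \<nu> a > 0"
    and \<rho>: "\<And>a. a \<in> J \<Longrightarrow> \<rho> a \<ge> 0" "(\<Sum>a\<in>J. \<rho> a) = 1"
  defines "w \<equiv> \<Sum>a\<in>J. \<rho> a *\<^sub>R v a"
    and "S \<equiv> \<Sum>a\<in>J. \<rho> a * (norm (v a))\<^sup>2"
    and "K \<equiv> \<Sum>a\<in>J. \<rho> a * ln (\<rho> a / \<nu> a)"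
  shows "(y + real N *\<^sub>R w) \<bullet> z - ((norm (y + real N *\<^sub>R w))\<^sup>2 + real N * S) / 2 - real N * K
           \<le> ln (atom_mixture \<nu> v I N y z)"
proof (induction N arbitrary: y)
  case 0
  then show ?case by simp
next
  case (Suc N)
  have fin: "finite J" using I J finite_subset by blast
  have ne: "J \<noteq> {}" using \<rho>(2) by auto
  have pos: "atom_mixture \<nu> v I N y z > 0" for y
    using I J ne \<nu> by (intro atom_mixture_pos) auto
  (* c is the mean of the sum after the N remaining draws, before the present atom is added. *)
  define c where "c = y + real N *\<^sub>R w"
  have cw: "c + w = y + real (Suc N) *\<^sub>R w"
    by (simp add: c_def algebra_simps)
  have "norm (c + v a)^2 = (norm c)\<^sup>2 + 2 * (c \<bullet> v a) + (norm (v a))\<^sup>2" for a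
    by (simp add: power2_norm_eq_inner inner_add_left inner_add_right inner_commute)
  then have "(\<Sum>a\<in>J. \<rho> a * (norm (c + v a))\<^sup>2)
      = (\<Sum>a\<in>J. \<rho> a * (norm c)\<^sup>2 + 2 * (\<rho> a * (c \<bullet> v a)) + \<rho> a * (norm (v a))\<^sup>2)"
    by (intro sum.cong) (auto simp: algebra_simps)
  also have "\<dots> = (norm c)\<^sup>2 + 2 * (c \<bullet> w) + S"
    by (simp add: sum.distrib S_def w_def inner_sum_right \<rho>(2)
        flip: sum_distrib_left sum_distrib_right)
  also have "\<dots> \<le> (norm (c + w))\<^sup>2 + S"
    by (simp add: power2_norm_eq_inner inner_add_left inner_add_right inner_commute)
  finally have sq: "(\<Sum>a\<in>J. \<rho> a * (norm (c + v a))\<^sup>2) \<le> (norm (c + w))\<^sup>2 + S" .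
  have lin: "(\<Sum>a\<in>J. \<rho> a * ((c + v a) \<bullet> z)) = (c + w) \<bullet> z"
    by (simp add: inner_add_left w_def inner_sum_left \<rho>(2) distrib_left sum.distrib
        flip: sum_distrib_right)
  have "(c + w) \<bullet> z - ((norm (c + w))\<^sup>2 + real (Suc N) * S) / 2 - real (Suc N) * K
      \<le> (\<Sum>a\<in>J. \<rho> a * ((c + v a) \<bullet> z)) - (\<Sum>a\<in>J. \<rho> a * (norm (c + v a))\<^sup>2) / 2
          - real N * S / 2 - real N * K - K"
    using sq by (simp add: lin field_simps)
  also have "\<dots> = (\<Sum>a\<in>J. \<rho> a * (((c + v a) \<bullet> z - ((norm (c + v a))\<^sup>2 + real N * S) / 2 - real N * K)
                      - ln (\<rho> a / \<nu> a)))"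
  proof -
    have "(\<Sum>a\<in>J. \<rho> a * (((c + v a) \<bullet> z - ((norm (c + v a))\<^sup>2 + real N * S) / 2 - real N * K)
                      - ln (\<rho> a / \<nu> a)))
        = (\<Sum>a\<in>J. \<rho> a * ((c + v a) \<bullet> z) - \<rho> a * (norm (c + v a))\<^sup>2 / 2
                      - \<rho> a * (real N * S / 2 + real N * K) - \<rho> a * ln (\<rho> a / \<nu> a))"
      by (intro sum.cong) (auto simp: field_simps)
    also have "\<dots> = (\<Sum>a\<in>J. \<rho> a * ((c + v a) \<bullet> z)) - (\<Sum>a\<in>J. \<rho> a * (norm (c + v a))\<^sup>2) / 2
                      - (\<Sum>a\<in>J. \<rho> a) * (real N * S / 2 + real N * K) - K"
      by (simp only: sum_subtractf sum_divide_distrib sum_distrib_right K_def)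
    finally show ?thesis
      using \<rho>(2) by simp
  qed
  also have "\<dots> \<le> (\<Sum>a\<in>J. \<rho> a * (ln (atom_mixture \<nu> v I N (y + v a) z) - ln (\<rho> a / \<nu> a)))"
  proof (intro sum_mono mult_left_mono diff_right_mono)
    fix a
    have "c + v a = y + v a + real N *\<^sub>R w" by (simp add: c_def)
    then show "(c + v a) \<bullet> z - ((norm (c + v a))\<^sup>2 + real N * S) / 2 - real N * K
        \<le> ln (atom_mixture \<nu> v I N (y + v a) z)"
      using Suc[of "y + v a"] by (simp only:)
  qed (use \<rho> in auto)
  also have "\<dots> \<le> ln (\<Sum>a\<in>J. \<nu> a * atom_mixture \<nu> v I N (y + v a) z)"
    using fin J \<rho> \<nu> pos by (intro Donsker_Varadhan_finite) auto
  also have "\<dots> \<le> ln (atom_mixture \<nu> v I (Suc N) y z)"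
  proof (rule ln_mono)
    show "(\<Sum>a\<in>J. \<nu> a * atom_mixture \<nu> v I N (y + v a) z) > 0"
      using fin ne J \<nu> pos by (intro sum_pos) auto
    show "(\<Sum>a\<in>J. \<nu> a * atom_mixture \<nu> v I N (y + v a) z) \<le> atom_mixture \<nu> v I (Suc N) y z"
      using I J \<nu> pos by (auto intro!: sum_mono2 simp: less_imp_le)
  qed
  finally show ?case by (simp only: cw)
qed

section \<open>The Gaussian noise against the sorted norm\<close>

text \<open>The entry of \<open>u\<close> of rank \<open>k\<close> will be represented by atoms of length of order \<open>sqrt (ln (2p / k))\<close>.
Rounding this length to dyadic classes of \<open>2p / k\<close> leaves only logarithmically many lengths, so that
the entropy for choosing one is affordable. The class \<open>i\<close> stands for
\<open>i * ln 2 \<le> ln (2p / k) \<le> (i + 1) * ln 2\<close>.\<close>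

definition atom_scale :: "nat \<Rightarrow> real" where
  "atom_scale i = sqrt (real (Suc i) * ln 2)"

text \<open>An atom \<open>Some (j, \<epsilon>, i)\<close> is the column \<open>j\<close> with sign \<open>\<epsilon>\<close> at the length of class \<open>i\<close>. The atom
\<open>None\<close> is zero and lets a draw do nothing.\<close>

definition atoms :: "('p::finite \<times> real \<times> nat) option set" where
  "atoms = insert None (Some ` (UNIV \<times> {-1, 1} \<times> {1..2 * CARD('p)}))"

definition atom_vec :: "('p \<Rightarrow> real ^ 'n) \<Rightarrow> ('p::finite \<times> real \<times> nat) option \<Rightarrow> real ^ 'n" where
  "atom_vec x a = (case a of None \<Rightarrow> 0 | Some (j, \<epsilon>, i) \<Rightarrow> (2 * \<epsilon> * atom_scale i) *\<^sub>R x j)"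

text \<open>The geometric factor makes the total weight of the nonzero atoms at most \<open>T / N\<close>, uniformly in
the number of classes. Its price \<open>i * ln 2\<close> in relative entropy is at most the unavoidable
price \<open>ln (2p / k)\<close> for choosing a column of rank \<open>k\<close>.\<close>

definition atom_weight :: "real \<Rightarrow> nat \<Rightarrow> ('p::finite \<times> real \<times> nat) option \<Rightarrow> real" where
  "atom_weight T N a =
     (case a of None \<Rightarrow> 1 | Some (j, \<epsilon>, i) \<Rightarrow> T * (1/2) ^ i / (2 * real CARD('p) * real N))"

lemma finite_atoms: "finite atoms" and atoms_nonempty: "atoms \<noteq> {}"
  by (auto simp: atoms_def)

lemma atom_weight_pos:
  assumes "T > 0" "N > 0"
  shows "atom_weight T N a > 0"
  using assms by (auto simp: atom_weight_def split: option.splits)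

lemma sum_atom_weight_power_le:
  assumes "T > 0" "N > 0"
  shows "(\<Sum>a\<in>(atoms :: ('p::finite \<times> real \<times> nat) option set). atom_weight T N a) ^ N \<le> exp T"
proof -
  let ?w = "atom_weight T N :: ('p \<times> real \<times> nat) option \<Rightarrow> real"
  have "(\<Sum>a\<in>atoms. ?w a)
      = 1 + (\<Sum>a\<in>(UNIV :: 'p set) \<times> {-1, 1 :: real} \<times> {1..2 * CARD('p)}. ?w (Some a))"
    unfolding atoms_def by (subst sum.insert) (auto simp: sum.reindex atom_weight_def)
  also have "(\<Sum>a\<in>(UNIV :: 'p set) \<times> {-1, 1 :: real} \<times> {1..2 * CARD('p)}. ?w (Some a))
      = T / real N * (\<Sum>i=1..2 * CARD('p). (1/2) ^ i)"
    by (simp add: sum.cartesian_product[symmetric] atom_weight_def sum_distrib_left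
        sum_divide_distrib)
  also have "(\<Sum>i=1..2 * CARD('p). (1/2 :: real) ^ i) \<le> 1"
  proof -
    have "(\<Sum>i=1..m. (1/2 :: real) ^ i) = 1 - (1/2) ^ m" for m
      by (induction m) auto
    then show ?thesis by simp
  qed
  finally have "(\<Sum>a\<in>atoms. ?w a) \<le> 1 + T / real N"
    using assms by (simp add: mult_left_le divide_right_mono)
  also have "\<dots> \<le> exp (T / real N)"
    by (rule exp_ge_add_one_self)
  finally have "(\<Sum>a\<in>atoms. ?w a) ^ N \<le> exp (T / real N) ^ N"
    using assms by (intro power_mono sum_nonneg) (auto intro: less_imp_le atom_weight_pos)
  also have "\<dots> = exp T"
    using assms by (simp flip: exp_of_nat_mult)
  finally show ?thesis .
qed

lemma dyadic_class:
  fixes p k :: nat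
  assumes "k \<in> {1..p}"
  shows "\<exists>i. i \<in> {1..2 * p} \<and> real i * ln 2 \<le> ln (2 * real p / real k)
           \<and> ln (2 * real p / real k) \<le> real (Suc i) * ln 2"
proof -
  have "2 * p div k \<ge> 2"
    using assms by (simp add: less_eq_div_iff_mult_less_eq)
  then obtain i where i: "2 ^ i \<le> 2 * p div k" "2 * p div k < 2 ^ (i + 1)"
    using ex_power_ivl1[of 2 "2 * p div k"] by auto
  have lo: "2 ^ i * k \<le> 2 * p" and hi: "2 * p < 2 ^ (i + 1) * k"
    using i assms by (simp_all add: less_eq_div_iff_mult_less_eq div_less_iff_less_mult)
  have "i \<noteq> 0" using i(2) \<open>2 * p div k \<ge> 2\<close> by (cases i) auto
  moreover have "i \<le> 2 * p"
  proof -
    have "i < 2 ^ i" by simp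
    also have "\<dots> \<le> 2 ^ i * k" using assms by simp
    finally show ?thesis using lo by simp
  qed
  moreover have "2 ^ i \<le> 2 * real p / real k"
  proof -
    have "real (2 ^ i * k) \<le> real (2 * p)" using lo by (simp only: of_nat_le_iff)
    then show ?thesis using assms by (simp add: field_simps)
  qed
  then have "ln (2 ^ i) \<le> ln (2 * real p / real k)"
    by (intro ln_mono) auto
  then have "real i * ln 2 \<le> ln (2 * real p / real k)"
    by (simp add: ln_realpow)
  moreover have "2 * real p / real k \<le> 2 ^ (i + 1)"
  proof -
    have "real (2 * p) \<le> real (2 ^ (i + 1) * k)" using hi by (simp only: of_nat_le_iff)
    then show ?thesis using assms by (simp add: field_simps)
  qed
  then have "ln (2 * real p / real k) \<le> ln (2 ^ (i + 1))"
    using assms by (intro ln_mono) auto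
  then have "ln (2 * real p / real k) \<le> real (Suc i) * ln 2"
    by (simp add: ln_realpow del: power_Suc)
  ultimately show ?thesis by (intro exI[of _ i]) auto
qed

text \<open>Here \<open>T = ln (1/\<delta>)\<close>. The law \<open>\<rho>\<close> is chosen so that the sum of \<open>N\<close> draws has mean \<open>2 T c\<close> with \<open>c\<close>
the combination \<open>\<Sum> u\<^sub>j x\<^sub>j\<close>. Divided by \<open>2 T\<close>, the logarithm of the mixture contributes at most
\<open>3/2\<close>, the squared mean at most \<open>1\<close>, and variance and entropy together at most \<open>5/2\<close>: an entry \<open>a\<close> of
rank \<open>k\<close> costs \<open>a (\<beta> + 3 \<eta>\<^sup>2 / (2 \<beta>))\<close>, where \<open>\<eta>\<^sup>2 = ln (2p/k)\<close>, and rounding \<open>\<eta>\<close> up to the class length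
\<open>\<beta>\<close> keeps \<open>\<beta>\<close> between \<open>\<eta>\<close> and \<open>3/2 \<eta>\<close>, where this is at most \<open>5/2 a \<eta>\<close>.\<close>

lemma inner_le_of_atom_mixture_normalized:
  fixes x :: "'p::finite \<Rightarrow> real ^ 'n" and u :: "'p \<Rightarrow> real" and z :: "real ^ 'n"
  assumes x: "\<And>j. norm (x j) \<le> 1"
    and \<phi>: "sorts_decreasing \<phi> (\<lambda>j. \<bar>u j\<bar>)"
    and T: "T \<ge> ln 2" and N: "real N \<ge> T / ln 2"
    and H: "(\<Sum>k=1..CARD('p). \<bar>u (\<phi> k)\<bar> * sqrt (ln (2 * real CARD('p) / real k))) \<le> 1"
    and G: "T * (norm (\<Sum>j\<in>UNIV. u j *\<^sub>R x j))\<^sup>2 \<le> 1"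
    and W: "ln (atom_mixture (atom_weight T N) (atom_vec x) atoms N 0 z) \<le> 2 * T + ln 2"
  shows "(\<Sum>j\<in>UNIV. u j *\<^sub>R x j) \<bullet> z \<le> 5"
proof -
  let ?p = "CARD('p)"
  have bij: "bij_betw \<phi> {1..?p} UNIV"
    and mono: "\<And>k l. 1 \<le> k \<Longrightarrow> k \<le> l \<Longrightarrow> l \<le> ?p \<Longrightarrow> \<bar>u (\<phi> l)\<bar> \<le> \<bar>u (\<phi> k)\<bar>"
    using \<phi> unfolding sorts_decreasing_def by auto
  have inj: "inj_on \<phi> {1..?p}" using bij by (simp add: bij_betw_def)
  have ln2: "(0::real) < ln 2" "1 / 2 \<le> ln (2::real)"
    using ln_2_less_1 exp_le ln_ge_iff[of 2 "1/2"] exp_half_le2 by auto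
  have T0: "T > 0" using T ln2 by linarith
  have N0: "N > 0"
  proof (rule ccontr)
    assume "\<not> N > 0"
    then show False using N T0 ln2 by (simp add: field_simps)
  qed
  define h where "h k = ln (2 * real ?p / real k)" for k
  define \<eta> where "\<eta> k = sqrt (h k)" for k
  obtain cl where cl: "\<And>k. k \<in> {1..?p} \<Longrightarrow> cl k \<in> {1..2 * ?p} \<and> real (cl k) * ln 2 \<le> h k
      \<and> h k \<le> real (Suc (cl k)) * ln 2"
    using dyadic_class[of _ ?p] unfolding h_def by metis
  define \<beta> where "\<beta> k = atom_scale (cl k)" for k
  define a where "a k = \<bar>u (\<phi> k)\<bar>" for k
  (* m k is the expected number of draws of the atom chosen for rank k. *)
  define m where "m k = a k * T / \<beta> k" for k
  define c where "c = (\<Sum>j\<in>UNIV. u j *\<^sub>R x j)"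
  have a0: "a k \<ge> 0" for k by (simp add: a_def)

  have h: "ln 2 \<le> h k" if k: "k \<in> {1..?p}" for k
  proof -
    have "1 * ln 2 \<le> real (cl k) * ln 2"
      using cl[OF k] ln2 by (intro mult_right_mono) auto
    then show ?thesis using cl[OF k] by linarith
  qed
  have \<eta>2: "(\<eta> k)\<^sup>2 = h k" and \<eta>0: "\<eta> k > 0" if k: "k \<in> {1..?p}" for k
    using h[OF k] ln2 by (auto simp: \<eta>_def)
  have \<beta>2: "(\<beta> k)\<^sup>2 = real (Suc (cl k)) * ln 2" and \<beta>0: "\<beta> k > 0" for k
    using ln2 by (auto simp: \<beta>_def atom_scale_def)
  have \<eta>\<beta>: "\<eta> k \<le> \<beta> k" if k: "k \<in> {1..?p}" for k
    using cl[OF k] by (simp add: \<eta>_def \<beta>_def atom_scale_def)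
  have \<beta>\<eta>: "\<beta> k \<le> 3 / 2 * \<eta> k" if k: "k \<in> {1..?p}" for k
  proof (rule power2_le_imp_le)
    have "1 * ln 2 \<le> real (cl k) * ln 2"
      using cl[OF k] ln2 by (intro mult_right_mono) auto
    then have "real (Suc (cl k)) * ln 2 \<le> 2 * (real (cl k) * ln 2)"
      by (simp add: algebra_simps)
    then have "(\<beta> k)\<^sup>2 \<le> 2 * h k" using cl[OF k] \<beta>2[of k] by linarith
    also have "\<dots> \<le> (3 / 2 * \<eta> k)\<^sup>2"
      unfolding power_mult_distrib \<eta>2[OF k] using h[OF k] ln2 by (simp add: power_divide)
    finally show "(\<beta> k)\<^sup>2 \<le> (3 / 2 * \<eta> k)\<^sup>2" .
  qed (use \<eta>0[OF k] in simp)
  (* Convexity in \<beta>: equality holds at both ends of the interval from \<eta> to 3/2 \<eta>. *)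
  have cost: "2 * \<beta> k + 3 * h k / \<beta> k \<le> 5 * \<eta> k" if k: "k \<in> {1..?p}" for k
  proof -
    have "(\<beta> k - \<eta> k) * (3 * \<eta> k - 2 * \<beta> k) \<ge> 0"
      using \<eta>\<beta>[OF k] \<beta>\<eta>[OF k] by (intro mult_nonneg_nonneg) auto
    then have "2 * (\<beta> k)\<^sup>2 + 3 * (\<eta> k)\<^sup>2 \<le> 5 * \<eta> k * \<beta> k"
      by (simp add: algebra_simps power2_eq_square)
    then show ?thesis
      using \<beta>0[of k] by (simp add: field_simps power2_eq_square flip: \<eta>2[OF k])
  qed
  (* The entries are decreasing, so the first k terms of H are all at least the k-th one. *)
  have a_le: "a k * (real k * \<eta> k) \<le> 1" if k: "k \<in> {1..?p}" for k
  proof -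
    have "a k * (real k * \<eta> k) = (\<Sum>l=1..k. a k * \<eta> k)" by simp
    also have "\<dots> \<le> (\<Sum>l=1..k. a l * \<eta> l)"
    proof (intro sum_mono mult_mono)
      fix l assume l: "l \<in> {1..k}"
      show "a k \<le> a l" using mono[of l k] l k by (simp add: a_def)
      have "2 * real ?p / real k \<le> 2 * real ?p / real l"
        using l k by (intro divide_left_mono) auto
      then have "h k \<le> h l"
        unfolding h_def using k by (intro ln_mono) auto
      then show "\<eta> k \<le> \<eta> l" by (simp add: \<eta>_def)
      show "0 \<le> a l" by (rule a0)
      show "0 \<le> \<eta> k" using \<eta>0[OF k] by simp
    qed
    also have "\<dots> \<le> (\<Sum>l=1..?p. a l * \<eta> l)"
      using k \<eta>0 a0 by (intro sum_mono2) (auto simp: less_imp_le)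
    also have "\<dots> \<le> 1" using H by (simp add: a_def \<eta>_def h_def)
    finally show ?thesis .
  qed

  define \<rho> where "\<rho> b = (case b of None \<Rightarrow> 1 - (\<Sum>k=1..?p. m k) / real N
      | Some (j, \<epsilon>, i) \<Rightarrow> \<bar>u j\<bar> * T / atom_scale i / real N)" for b :: "('p \<times> real \<times> nat) option"
  define sg where "sg y = (if y < 0 then -1 else 1 :: real)" for y :: real
  define g where "g k = Some (\<phi> k, sg (u (\<phi> k)), cl k)" for k
  define J where "J = insert None (g ` {1..?p})"
  have injg: "inj_on g {1..?p}"
    using inj_onD[OF inj] by (intro inj_onI) (simp add: g_def)
  have sumJ: "(\<Sum>b\<in>J. f b) = f None + (\<Sum>k=1..?p. f (g k))"
    for f :: "('p \<times> real \<times> nat) option \<Rightarrow> 'c::comm_monoid_add"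
  proof -
    have "None \<notin> g ` {1..?p}" by (auto simp: g_def)
    then show ?thesis using injg by (simp add: J_def sum.reindex)
  qed
  have \<rho>g: "\<rho> (g k) = m k / real N" for k
    by (simp add: \<rho>_def g_def m_def a_def \<beta>_def)
  have m0: "m k \<ge> 0" for k using a0[of k] \<beta>0[of k] T0 by (simp add: m_def)
  have JI: "J \<subseteq> atoms"
    using cl by (auto simp: J_def atoms_def g_def sg_def)
  (* This is where N must be large: the expected number of nonzero draws cannot exceed N. *)
  have m_sum: "(\<Sum>k=1..?p. m k) \<le> real N"
  proof -
    have "m k \<le> T / ln 2 * (a k * \<eta> k)" if k: "k \<in> {1..?p}" for k
    proof -
      have "ln 2 \<le> \<eta> k * \<beta> k"
        using h[OF k] \<eta>2[OF k] mult_left_mono[OF \<eta>\<beta>[OF k], of "\<eta> k"] \<eta>0[OF k]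
        by (simp add: power2_eq_square)
      then have "(a k * T) * ln 2 \<le> (a k * T) * (\<eta> k * \<beta> k)"
        using a0[of k] T0 by (intro mult_left_mono) auto
      then show ?thesis
        using \<beta>0[of k] ln2 by (simp add: m_def field_simps)
    qed
    then have "(\<Sum>k=1..?p. m k) \<le> T / ln 2 * (\<Sum>k=1..?p. a k * \<eta> k)"
      unfolding sum_distrib_left by (rule sum_mono)
    also have "\<dots> \<le> T / ln 2 * 1"
      using H T0 ln2 by (intro mult_left_mono) (auto simp: a_def \<eta>_def h_def)
    finally show ?thesis using N by simp
  qed
  have \<rho>None: "0 \<le> \<rho> None" "\<rho> None \<le> 1"
    using m_sum m0 N0 by (auto simp: \<rho>_def sum_nonneg)
  have \<rho>_nonneg: "\<rho> b \<ge> 0" if "b \<in> J" for b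
    using that m0 \<rho>g \<rho>None by (auto simp: J_def)
  have \<rho>_sum: "(\<Sum>b\<in>J. \<rho> b) = 1"
    unfolding sumJ \<rho>g by (simp add: \<rho>_def sum_divide_distrib)

  have "(\<Sum>b\<in>J. \<rho> b *\<^sub>R atom_vec x b) = (\<Sum>k=1..?p. (2 * T / real N) *\<^sub>R (u (\<phi> k) *\<^sub>R x (\<phi> k)))"
    unfolding sumJ \<rho>g
  proof -
    have "(m k / real N) *\<^sub>R atom_vec x (g k) = (2 * T / real N) *\<^sub>R (u (\<phi> k) *\<^sub>R x (\<phi> k))" for k
      using \<beta>0[of k] by (simp add: m_def atom_vec_def g_def a_def sg_def flip: \<beta>_def)
    then show "\<rho> None *\<^sub>R atom_vec x None + (\<Sum>k=1..?p. (m k / real N) *\<^sub>R atom_vec x (g k))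
        = (\<Sum>k=1..?p. (2 * T / real N) *\<^sub>R (u (\<phi> k) *\<^sub>R x (\<phi> k)))"
      by (simp add: atom_vec_def)
  qed
  also have "\<dots> = (2 * T / real N) *\<^sub>R (\<Sum>k=1..?p. u (\<phi> k) *\<^sub>R x (\<phi> k))"
    by (simp add: scaleR_sum_right)
  also have "(\<Sum>k=1..?p. u (\<phi> k) *\<^sub>R x (\<phi> k)) = c"
    unfolding c_def using bij by (rule sum.reindex_bij_betw)
  finally have mean: "real N *\<^sub>R (\<Sum>b\<in>J. \<rho> b *\<^sub>R atom_vec x b) = (2 * T) *\<^sub>R c"
    using N0 by simp

  have "real N * (\<Sum>b\<in>J. \<rho> b * (norm (atom_vec x b))\<^sup>2)
      = (\<Sum>k=1..?p. m k * (norm (atom_vec x (g k)))\<^sup>2)"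
    unfolding sumJ \<rho>g using N0 by (simp add: atom_vec_def sum_distrib_left)
  also have "\<dots> \<le> (\<Sum>k=1..?p. T * (4 * a k * \<beta> k))"
  proof (rule sum_mono)
    fix k
    have "norm (atom_vec x (g k)) \<le> 2 * \<beta> k"
      using mult_left_mono[OF x[of "\<phi> k"], of "2 * \<beta> k"] \<beta>0[of k]
      by (simp add: atom_vec_def g_def sg_def abs_mult flip: \<beta>_def)
    then have "(norm (atom_vec x (g k)))\<^sup>2 \<le> (2 * \<beta> k)\<^sup>2"
      by (intro power_mono) auto
    then have "m k * (norm (atom_vec x (g k)))\<^sup>2 \<le> m k * (2 * \<beta> k)\<^sup>2"
      using m0[of k] by (rule mult_left_mono)
    also have "\<dots> = T * (4 * a k * \<beta> k)"
      using \<beta>0[of k] by (simp add: m_def power2_eq_square)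
    finally show "m k * (norm (atom_vec x (g k)))\<^sup>2 \<le> T * (4 * a k * \<beta> k)" .
  qed
  finally have second: "real N * (\<Sum>b\<in>J. \<rho> b * (norm (atom_vec x b))\<^sup>2)
      \<le> (\<Sum>k=1..?p. T * (4 * a k * \<beta> k))" .

  have "real N * (\<Sum>b\<in>J. \<rho> b * ln (\<rho> b / atom_weight T N b))
      = real N * (\<rho> None * ln (\<rho> None))
        + (\<Sum>k=1..?p. m k * ln ((m k / real N) / atom_weight T N (g k)))"
    unfolding sumJ \<rho>g using N0 by (simp add: atom_weight_def sum_distrib_left distrib_left)
  also have "\<dots> \<le> 0 + (\<Sum>k=1..?p. T * (3 * a k * h k / \<beta> k))"
  proof (intro add_mono sum_mono)
    have "\<rho> None * ln (\<rho> None) \<le> 0"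
      using \<rho>None by (cases "\<rho> None = 0") (auto intro!: mult_nonneg_nonpos)
    then show "real N * (\<rho> None * ln (\<rho> None)) \<le> 0"
      by (simp add: mult_nonneg_nonpos)
  next
    fix k assume k: "k \<in> {1..?p}"
    show "m k * ln ((m k / real N) / atom_weight T N (g k)) \<le> T * (3 * a k * h k / \<beta> k)"
    proof (cases "a k = 0")
      case True
      then show ?thesis by (simp add: m_def)
    next
      case False
      then have apos: "a k > 0" using a0[of k] by simp
      have k0: "real k > 0" using k by simp
      have expk: "exp (h k) = 2 * real ?p / real k"
        using k by (simp add: h_def)
      have two: "2 ^ cl k \<le> exp (h k)"
      proof -
        have "exp (real (cl k) * ln 2) \<le> exp (h k)" using cl[OF k] by simp
        then show ?thesis by (simp add: exp_of_nat_mult)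
      qed
      have inv: "1 \<le> \<eta> k * \<beta> k * exp (h k)"
      proof -
        have "1 / 2 \<le> \<eta> k * \<beta> k"
          using h[OF k] ln2 \<eta>2[OF k] mult_left_mono[OF \<eta>\<beta>[OF k], of "\<eta> k"] \<eta>0[OF k]
          by (simp add: power2_eq_square)
        moreover have "2 \<le> exp (h k)"
          using h[OF k] by (metis exp_le_cancel_iff exp_ln zero_less_numeral)
        ultimately have "1 / 2 * 2 \<le> (\<eta> k * \<beta> k) * exp (h k)"
          by (intro mult_mono) (use \<eta>0[OF k] \<beta>0[of k] in auto)
        then show ?thesis by simp
      qed
      have "(m k / real N) / atom_weight T N (g k) = a k * (2 * real ?p) * 2 ^ cl k / \<beta> k"
        using T0 N0 \<beta>0[of k] by (simp add: atom_weight_def g_def m_def field_simps)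
      also have "\<dots> = a k * real k * exp (h k) * 2 ^ cl k / \<beta> k"
        using k0 by (simp add: expk)
      also have "\<dots> \<le> a k * real k * exp (h k) * exp (h k) / \<beta> k"
        using two a0[of k] \<beta>0[of k] by (intro divide_right_mono mult_left_mono) auto
      (* The third factor exp (h k) absorbs 1 / (\<eta> k * \<beta> k), which is at most 2. *)
      also have "\<dots> \<le> a k * real k * exp (h k) * exp (h k) / \<beta> k * (\<eta> k * \<beta> k * exp (h k))"
        using mult_left_mono[OF inv, of "a k * real k * exp (h k) * exp (h k) / \<beta> k"] a0[of k] \<beta>0[of k]
        by simp
      also have "\<dots> = (a k * (real k * \<eta> k)) * (exp (h k) * exp (h k) * exp (h k))"
        using \<beta>0[of k] by (simp add: field_simps)
      also have "\<dots> \<le> 1 * (exp (h k) * exp (h k) * exp (h k))"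
        using a_le[OF k] by (intro mult_right_mono) auto
      also have "\<dots> = exp (3 * h k)"
        by (simp flip: exp_add)
      finally have "(m k / real N) / atom_weight T N (g k) \<le> exp (3 * h k)" .
      moreover have "(m k / real N) / atom_weight T N (g k) > 0"
        using apos T0 N0 \<beta>0[of k] by (intro divide_pos_pos atom_weight_pos) (auto simp: m_def)
      ultimately have "ln ((m k / real N) / atom_weight T N (g k)) \<le> 3 * h k"
        by (metis ln_exp ln_mono)
      then have "m k * ln ((m k / real N) / atom_weight T N (g k)) \<le> m k * (3 * h k)"
        using m0[of k] by (rule mult_left_mono)
      also have "\<dots> = T * (3 * a k * h k / \<beta> k)"
        by (simp add: m_def)
      finally show ?thesis .
    qed
  qed
  finally have entropy: "real N * (\<Sum>b\<in>J. \<rho> b * ln (\<rho> b / atom_weight T N b))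
      \<le> (\<Sum>k=1..?p. T * (3 * a k * h k / \<beta> k))" by simp

  have "(\<Sum>k=1..?p. T * (4 * a k * \<beta> k)) / 2 + (\<Sum>k=1..?p. T * (3 * a k * h k / \<beta> k))
      = T * (\<Sum>k=1..?p. a k * (2 * \<beta> k + 3 * h k / \<beta> k))"
    by (simp add: sum_distrib_left sum_divide_distrib algebra_simps flip: sum.distrib)
  also have "\<dots> \<le> T * (\<Sum>k=1..?p. a k * (5 * \<eta> k))"
    using T0 a0 cost by (intro mult_left_mono sum_mono) auto
  also have "\<dots> = 5 * T * (\<Sum>k=1..?p. a k * \<eta> k)"
    by (simp add: sum_distrib_left mult_ac)
  also have "\<dots> \<le> 5 * T * 1"
    using H T0 by (intro mult_left_mono) (auto simp: a_def \<eta>_def h_def)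
  finally have total: "(\<Sum>k=1..?p. T * (4 * a k * \<beta> k)) / 2
      + (\<Sum>k=1..?p. T * (3 * a k * h k / \<beta> k)) \<le> 5 * T" by simp

  have "(0 + (2 * T) *\<^sub>R c) \<bullet> z
      - ((norm (0 + (2 * T) *\<^sub>R c))\<^sup>2 + real N * (\<Sum>b\<in>J. \<rho> b * (norm (atom_vec x b))\<^sup>2)) / 2
      - real N * (\<Sum>b\<in>J. \<rho> b * ln (\<rho> b / atom_weight T N b))
      \<le> ln (atom_mixture (atom_weight T N) (atom_vec x) atoms N 0 z)"
    unfolding mean[symmetric]
    by (rule atom_mixture_lower_bound) (use finite_atoms JI atom_weight_pos T0 N0 \<rho>_nonneg \<rho>_sum in auto)
  then have "2 * T * (c \<bullet> z) \<le> 2 * T + ln 2 + (norm ((2 * T) *\<^sub>R c))\<^sup>2 / 2 + 5 * T"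
    using W second entropy total by (simp add: add_divide_distrib)
  also have "(norm ((2 * T) *\<^sub>R c))\<^sup>2 / 2 = 2 * T * (T * (norm c)\<^sup>2)"
    by (simp add: power_mult_distrib power2_eq_square)
  also have "\<dots> \<le> 2 * T * 1"
    using G T0 by (intro mult_left_mono) (auto simp: c_def)
  finally have "2 * T * (c \<bullet> z) \<le> 2 * T * 5"
    using T by linarith
  then show ?thesis
    using T0 by (simp add: c_def)
qed

text \<open>Both sides are homogeneous of degree one in \<open>u\<close>, so the maximum can be scaled to one.\<close>

lemma inner_le_of_atom_mixture:
  fixes x :: "'p::finite \<Rightarrow> real ^ 'n" and u :: "'p \<Rightarrow> real" and z :: "real ^ 'n"
  assumes x: "\<And>j. norm (x j) \<le> 1"
    and \<phi>: "sorts_decreasing \<phi> (\<lambda>j. \<bar>u j\<bar>)"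
    and T: "T \<ge> ln 2" and N: "real N \<ge> T / ln 2"
    and W: "ln (atom_mixture (atom_weight T N) (atom_vec x) atoms N 0 z) \<le> 2 * T + ln 2"
  shows "(\<Sum>j\<in>UNIV. u j *\<^sub>R x j) \<bullet> z
           \<le> 5 * max (\<Sum>k=1..CARD('p). \<bar>u (\<phi> k)\<bar> * sqrt (ln (2 * real CARD('p) / real k)))
                     (sqrt T * norm (\<Sum>j\<in>UNIV. u j *\<^sub>R x j))"
    (is "?c \<bullet> z \<le> 5 * max ?H (sqrt T * norm ?c)")
proof -
  let ?p = "CARD('p)"
  have ln2: "(0::real) < ln 2" by simp
  have T0: "T > 0" using T ln2 by linarith
  have lpos: "sqrt (ln (2 * real ?p / real k)) > 0" if "k \<in> {1..?p}" for k
    using that by simp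
  define t where "t = max ?H (sqrt T * norm ?c)"
  have "?H \<ge> 0"
    using lpos by (intro sum_nonneg mult_nonneg_nonneg) (auto simp: less_imp_le)
  then have t0: "t \<ge> 0" by (simp add: t_def)
  show ?thesis
  proof (cases "t = 0")
    case True
    then have "norm ?c = 0"
      using T0 by (smt (verit, best) t_def max.cobounded2 norm_ge_zero real_sqrt_gt_zero mult_pos_pos)
    then show ?thesis using t0 by (simp add: t_def)
  next
    case False
    then have t: "t > 0" using t0 by simp
    have c: "(\<Sum>j\<in>UNIV. (u j / t) *\<^sub>R x j) = (1 / t) *\<^sub>R ?c"
      by (simp add: scaleR_sum_right)
    have "(\<Sum>j\<in>UNIV. (u j / t) *\<^sub>R x j) \<bullet> z \<le> 5"
    proof (rule inner_le_of_atom_mixture_normalized[OF x _ T N _ _ W])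
      show "sorts_decreasing \<phi> (\<lambda>j. \<bar>u j / t\<bar>)"
        using \<phi> t by (simp add: sorts_decreasing_def divide_right_mono)
      have "(\<Sum>k=1..?p. \<bar>u (\<phi> k) / t\<bar> * sqrt (ln (2 * real ?p / real k))) = ?H / t"
        using t by (simp add: sum_divide_distrib)
      also have "\<dots> \<le> 1" using t by (simp add: t_def)
      finally show "(\<Sum>k=1..?p. \<bar>u (\<phi> k) / t\<bar> * sqrt (ln (2 * real ?p / real k))) \<le> 1" .
      have "sqrt T * norm ?c \<le> t" by (simp add: t_def)
      then have "(sqrt T * norm ?c)\<^sup>2 \<le> t\<^sup>2"
        using T0 by (intro power_mono) auto
      then show "T * (norm (\<Sum>j\<in>UNIV. (u j / t) *\<^sub>R x j))\<^sup>2 \<le> 1"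
        unfolding c using T0 t by (simp add: power_mult_distrib power_divide)
    qed
    then have "?c \<bullet> z \<le> 5 * t"
      using t unfolding c by (simp add: field_simps)
    then show ?thesis by (simp only: t_def)
  qed
qed

text \<open>The event is that the mixture stays below \<open>2 exp (2 T)\<close>. Its mean is at most \<open>exp T\<close>, so by Markov's
inequality this fails with probability at most \<open>exp (- T) / 2 = \<delta> / 2\<close>. The event does not refer to \<open>u\<close>.
The restriction \<open>\<delta> \<le> 1/2\<close> makes \<open>ln 2 \<le> T\<close>, so that the factor \<open>2\<close> is absorbed.\<close>

lemma gaussian_noise_bound:
  fixes x :: "'p::finite \<Rightarrow> real ^ 'n" and \<xi> :: "'w \<Rightarrow> real ^ 'n"
  assumes M: "prob_space M" and \<sigma>: "\<sigma> > 0" and \<xi>: "isotropic_normal M \<sigma> \<xi>"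
    and x: "\<And>j. norm (x j) \<le> 1" and \<delta>: "0 < \<delta>" "\<delta> \<le> 1 / 2"
  shows "\<exists>E\<in>sets M. 1 - \<delta> / 2 \<le> measure M E \<and>
    (\<forall>\<omega>\<in>E. \<forall>u \<phi>. sorts_decreasing \<phi> (\<lambda>j. \<bar>u j\<bar>) \<longrightarrow>
       (\<Sum>j\<in>UNIV. u j *\<^sub>R x j) \<bullet> \<xi> \<omega>
         \<le> 5 * \<sigma> * max (\<Sum>k=1..CARD('p). \<bar>u (\<phi> k)\<bar> * sqrt (ln (2 * real CARD('p) / real k)))
                     (sqrt (ln (1 / \<delta>)) * norm (\<Sum>j\<in>UNIV. u j *\<^sub>R x j)))"
proof -
  interpret prob_space M by (rule M)
  define T where "T = ln (1 / \<delta>)"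
  define N where "N = nat \<lceil>T / ln 2\<rceil>"
  define \<zeta> where "\<zeta> \<omega> = (1 / \<sigma>) *\<^sub>R \<xi> \<omega>" for \<omega>
  define W where "W z = atom_mixture (atom_weight T N) (atom_vec x) atoms N 0 z" for z
  have T: "T \<ge> ln 2"
    unfolding T_def using \<delta> by (intro ln_mono) (auto simp: field_simps)
  then have T0: "T > 0" using ln_gt_zero[of "2::real"] by linarith
  have N: "real N \<ge> T / ln 2" unfolding N_def by linarith
  then have N0: "N > 0"
    using T0 by (intro gr0I) (auto simp: zero_less_divide_iff dest: leD)
  have expT: "exp T = 1 / \<delta>" using \<delta> by (simp add: T_def)
  have \<zeta>: "\<zeta> \<in> borel_measurable M"
    unfolding \<zeta>_def using isotropic_normal_measurable[OF \<xi>] by measurable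
  have Wpos: "W z > 0" for z
    unfolding W_def using finite_atoms atoms_nonempty atom_weight_pos[OF T0 N0]
    by (rule atom_mixture_pos)
  have WM: "(\<lambda>\<omega>. W (\<zeta> \<omega>)) \<in> borel_measurable M"
    unfolding W_def by (rule measurable_compose[OF \<zeta> atom_mixture_measurable])
  have "(\<integral>\<^sup>+\<omega>. ennreal (W (\<zeta> \<omega>)) \<partial>M)
      = ennreal ((\<Sum>a\<in>(atoms :: ('p \<times> real \<times> nat) option set). atom_weight T N a) ^ N)"
    unfolding W_def
    by (rule atom_mixture_expectation[OF finite_atoms atoms_nonempty atom_weight_pos[OF T0 N0] \<zeta>])
      (simp only: \<zeta>_def isotropic_normal_exp_moment[OF M \<sigma> \<xi>])
  also have "\<dots> \<le> ennreal (exp T)"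
    using sum_atom_weight_power_le[OF T0 N0] by (rule ennreal_leI)
  finally have EW: "(\<integral>\<^sup>+\<omega>. ennreal (W (\<zeta> \<omega>)) \<partial>M) \<le> ennreal (exp T)" .
  define t where "t = 2 * exp T * exp T"
  have t: "t > 0" by (simp add: t_def)
  define B where "B = {\<omega> \<in> space M. t \<le> W (\<zeta> \<omega>)}"
  have B: "B \<in> sets M" unfolding B_def using WM by measurable
  have "emeasure M {\<omega> \<in> space M. 1 \<le> ennreal (1 / t) * ennreal (W (\<zeta> \<omega>))}
      \<le> ennreal (1 / t) * (\<integral>\<^sup>+\<omega>. ennreal (W (\<zeta> \<omega>)) * indicator (space M) \<omega> \<partial>M)"
    using WM by (intro nn_integral_Markov_inequality) auto
  also have "{\<omega> \<in> space M. 1 \<le> ennreal (1 / t) * ennreal (W (\<zeta> \<omega>))} = B"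
    using t Wpos by (auto simp: B_def field_simps less_imp_le simp flip: ennreal_mult ennreal_1)
  also have "(\<integral>\<^sup>+\<omega>. ennreal (W (\<zeta> \<omega>)) * indicator (space M) \<omega> \<partial>M)
      = (\<integral>\<^sup>+\<omega>. ennreal (W (\<zeta> \<omega>)) \<partial>M)"
    by (intro nn_integral_cong) auto
  also have "ennreal (1 / t) * \<dots> \<le> ennreal (1 / t) * ennreal (exp T)"
    using EW by (rule mult_left_mono) simp
  also have "\<dots> = ennreal (\<delta> / 2)"
    using \<delta> by (simp add: t_def expT flip: ennreal_mult)
  finally have "prob B \<le> \<delta> / 2"
    using \<delta> by (simp add: emeasure_eq_measure)
  then have prob: "1 - \<delta> / 2 \<le> prob (space M - B)"
    using B by (simp add: prob_compl)
  show ?thesis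
  proof (intro bexI[of _ "space M - B"] conjI ballI allI impI)
    fix \<omega> \<phi> and u :: "'p \<Rightarrow> real"
    assume \<omega>: "\<omega> \<in> space M - B" and \<phi>: "sorts_decreasing \<phi> (\<lambda>j. \<bar>u j\<bar>)"
    have "W (\<zeta> \<omega>) \<le> t" using \<omega> by (auto simp: B_def)
    then have "ln (W (\<zeta> \<omega>)) \<le> ln t" using Wpos by (intro ln_mono) auto
    also have "ln t = 2 * T + ln 2" by (simp add: t_def ln_mult)
    finally have W: "ln (W (\<zeta> \<omega>)) \<le> 2 * T + ln 2" .
    from mult_left_mono[OF inner_le_of_atom_mixture[OF x \<phi> T N W[unfolded W_def]], of \<sigma>] \<sigma>
    show "(\<Sum>j\<in>UNIV. u j *\<^sub>R x j) \<bullet> \<xi> \<omega>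
         \<le> 5 * \<sigma> * max (\<Sum>k=1..CARD('p). \<bar>u (\<phi> k)\<bar> * sqrt (ln (2 * real CARD('p) / real k)))
                     (sqrt (ln (1 / \<delta>)) * norm (\<Sum>j\<in>UNIV. u j *\<^sub>R x j))"
      by (simp add: \<zeta>_def mult_ac flip: T_def)
  qed (use B prob in auto)
qed

section \<open>Deterministic analysis of the Slope estimator\<close>

lemma emp_norm_eq_norm: "emp_norm (v :: real ^ 'n) = norm v / sqrt (real CARD('n))"
proof -
  have "norm v = sqrt (\<Sum>i\<in>UNIV. (v $ i)\<^sup>2)"
    unfolding norm_eq_sqrt_inner inner_vec_def by (simp add: power2_eq_square)
  then show ?thesis by (simp add: emp_norm_def real_sqrt_divide)
qed

lemma emp_norm_nonneg: "emp_norm v \<ge> 0"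
  by (simp add: emp_norm_eq_norm)

lemma emp_norm_squared: "(emp_norm (v :: real ^ 'n))\<^sup>2 = v \<bullet> v / real CARD('n)"
  by (simp add: emp_norm_eq_norm power_divide power2_norm_eq_inner)

lemma le_zero_of_le_small_multiples:
  fixes a K :: real
  assumes K: "K \<ge> 0" and le: "\<And>t. 0 < t \<Longrightarrow> t \<le> 1 \<Longrightarrow> a \<le> t * K"
  shows "a \<le> 0"
proof (rule ccontr)
  assume "\<not> a \<le> 0"
  then have a: "a > 0" by simp
  define t where "t = min 1 (a / (K + 1))"
  have "a \<le> t * K" using a K by (intro le) (auto simp: t_def)
  also have "\<dots> \<le> a / (K + 1) * K"
    using K by (intro mult_right_mono) (auto simp: t_def)
  also have "\<dots> < a" using a K by (simp add: field_simps)
  finally show False by simp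
qed

text \<open>Optimality of \<open>bh\<close> against \<open>(1 - t) bh + t b\<close>, divided by \<open>t\<close>; the quadratic term disappears as
\<open>t\<close> tends to zero.\<close>

lemma slope_first_order:
  fixes X :: "real ^ 'p ^ 'n"
  assumes lam: "decreasing_weights CARD('p) lam" and bh: "slope_estimator X lam y bh"
  shows "(X *v bh - y) \<bullet> (X *v (bh - b)) / real CARD('n) \<le> sorted_l1 lam b - sorted_l1 lam bh"
proof -
  define P where "P = X *v bh - y"
  define D where "D = X *v (bh - b)"
  define \<Delta> where "\<Delta> = sorted_l1 lam b - sorted_l1 lam bh"
  let ?n = "real CARD('n)"
  have "2 * (P \<bullet> D) / ?n - 2 * \<Delta> \<le> 0"
  proof (rule le_zero_of_le_small_multiples)
    show "0 \<le> D \<bullet> D / ?n" by simp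
    fix t :: real assume t: "0 < t" "t \<le> 1"
    define bt where "bt = (1 - t) *\<^sub>R bh + t *\<^sub>R b"
    have Xbt: "X *v bt - y = P - t *\<^sub>R D"
      by (simp add: bt_def P_def D_def matrix_vector_right_distrib matrix_vector_mult_scaleR
          matrix_vector_mult_diff_distrib algebra_simps)
    have "(emp_norm (X *v bh - y))\<^sup>2 + 2 * sorted_l1 lam bh
        \<le> (emp_norm (X *v bt - y))\<^sup>2 + 2 * sorted_l1 lam bt"
      using bh unfolding slope_estimator_def is_arg_min_linorder by simp
    also have "sorted_l1 lam bt \<le> (1 - t) * sorted_l1 lam bh + t * sorted_l1 lam b"
      unfolding bt_def using t by (intro sorted_l1_convex_combination lam) auto
    finally have "P \<bullet> P / ?n \<le> (P - t *\<^sub>R D) \<bullet> (P - t *\<^sub>R D) / ?n + 2 * t * \<Delta>"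
      unfolding Xbt emp_norm_squared P_def[symmetric] by (simp add: \<Delta>_def algebra_simps)
    moreover have "(P - t *\<^sub>R D) \<bullet> (P - t *\<^sub>R D) = P \<bullet> P - 2 * t * (P \<bullet> D) + t * t * (D \<bullet> D)"
      by (simp add: inner_diff_left inner_diff_right inner_commute algebra_simps)
    ultimately have "0 \<le> t * (t * (D \<bullet> D / ?n) - (2 * (P \<bullet> D) / ?n - 2 * \<Delta>))"
      by (simp add: field_simps)
    then show "2 * (P \<bullet> D) / ?n - 2 * \<Delta> \<le> t * (D \<bullet> D / ?n)"
      using t by (simp add: zero_le_mult_iff)
  qed
  then show ?thesis by (simp add: P_def D_def \<Delta>_def)
qed

text \<open>The first-order condition keeps the term \<open>\<parallel>X (bh - b)\<parallel>\<^sup>2\<close> on the left, which a direct comparison of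
the objective at \<open>bh\<close> and at \<open>b\<close> would lose. It is the term in which the square is completed later, and
it is why \<open>\<parallel>X b - f\<parallel>\<^sup>2\<close> appears with constant one.\<close>

lemma slope_basic_inequality:
  fixes X :: "real ^ 'p ^ 'n"
  assumes "decreasing_weights CARD('p) lam" and "slope_estimator X lam (f + \<xi>) bh"
  shows "(emp_norm (X *v bh - f))\<^sup>2 + (emp_norm (X *v (bh - b)))\<^sup>2
           \<le> (emp_norm (X *v b - f))\<^sup>2 + 2 * (\<xi> \<bullet> (X *v (bh - b))) / real CARD('n)
              + 2 * (sorted_l1 lam b - sorted_l1 lam bh)"
proof -
  define v where "v = X *v bh - f"
  define D where "D = X *v (bh - b)"
  let ?n = "real CARD('n)"
  have b: "X *v b - f = v - D" and y: "X *v bh - (f + \<xi>) = v - \<xi>"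
    by (simp_all add: v_def D_def matrix_vector_mult_diff_distrib)
  have "2 * ((v - \<xi>) \<bullet> D / ?n) \<le> 2 * (sorted_l1 lam b - sorted_l1 lam bh)"
    using slope_first_order[OF assms, of b] by (simp add: y D_def)
  moreover have "v \<bullet> v / ?n + D \<bullet> D / ?n
      = (v - D) \<bullet> (v - D) / ?n + 2 * (\<xi> \<bullet> D) / ?n + 2 * ((v - \<xi>) \<bullet> D / ?n)"
    by (simp add: inner_diff_left inner_diff_right inner_commute field_simps)
  ultimately show ?thesis
    unfolding emp_norm_squared b v_def[symmetric] D_def[symmetric] by linarith
qed

lemma decreasing_weights_le:
  assumes "decreasing_weights p lam" "1 \<le> k" "k \<le> l" "l \<le> p"
  shows "lam l \<le> lam k"
  using assms(3,4)
proof (induction l rule: dec_induct)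
  case (step l)
  then have "lam (Suc l) \<le> lam l"
    using assms by (auto simp: decreasing_weights_def)
  then show ?case using step by simp
qed simp

lemma wre_const_le:
  assumes "d \<in> wre_cone lam s c0"
  shows "wre_const X lam s c0 * norm d \<le> emp_norm (X *v d)"
proof (cases "d = 0")
  case True
  then show ?thesis by (simp add: emp_norm_nonneg)
next
  case False
  have "bdd_below ((\<lambda>d. emp_norm (X *v d) / norm d) ` (wre_cone lam s c0 - {0}))"
    by (intro bdd_belowI[of _ 0]) (auto simp: emp_norm_nonneg)
  then have "wre_const X lam s c0 \<le> emp_norm (X *v d) / norm d"
    unfolding wre_const_def using assms False by (intro cINF_lower) auto
  then show ?thesis using False by (simp add: field_simps)
qed

text \<open>A nonzero element of the cone is needed to know that the infimum in \<open>wre_const\<close> is over a nonempty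
set. The canonical basis vectors also show that it is at most one.\<close>

lemma axis_in_wre_cone:
  assumes lam: "decreasing_weights CARD('p) lam" and s: "s \<in> {1..CARD('p)}" and c0: "c0 \<ge> 0"
  shows "(axis j 1 :: real ^ 'p) \<in> wre_cone lam s c0"
proof -
  let ?e = "axis j 1 :: real ^ 'p"
  obtain \<phi> where \<phi>: "sorts_decreasing \<phi> (\<lambda>i. \<bar>?e $ i\<bar>)"
    using ex_sorts_decreasing[of "\<lambda>i. \<bar>?e $ i\<bar>"] by blast
  then have bij: "bij_betw \<phi> {1..CARD('p)} UNIV"
    by (simp add: sorts_decreasing_def)
  have "sorted_l1 lam ?e = (\<Sum>k=1..CARD('p). lam k * \<bar>?e $ \<phi> k\<bar>)"
    by (rule sorted_l1_eq_of_sorts_decreasing[OF \<phi>])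
  also have "\<dots> \<le> (\<Sum>k=1..CARD('p). lam 1 * \<bar>?e $ \<phi> k\<bar>)"
    using decreasing_weights_le[OF lam] by (intro sum_mono mult_right_mono) auto
  also have "\<dots> = lam 1 * (\<Sum>k=1..CARD('p). \<bar>?e $ \<phi> k\<bar>)"
    by (simp add: sum_distrib_left)
  also have "(\<Sum>k=1..CARD('p). \<bar>?e $ \<phi> k\<bar>) = (\<Sum>i\<in>UNIV. \<bar>?e $ i\<bar>)"
    using bij by (rule sum.reindex_bij_betw)
  also have "\<dots> = 1" by (simp add: axis_def if_distrib cong: if_cong)
  finally have "sorted_l1 lam ?e \<le> lam 1" by simp
  also have "lam 1 \<le> sqrt (\<Sum>j=1..s. (lam j)\<^sup>2)"
    using s by (intro real_le_rsqrt member_le_sum) auto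
  also have "\<dots> \<le> (1 + c0) * sqrt (\<Sum>j=1..s. (lam j)\<^sup>2)"
    using mult_right_mono[of 1 "1 + c0" "sqrt (\<Sum>j=1..s. (lam j)\<^sup>2)"] c0 by (simp add: sum_nonneg)
  finally show ?thesis by (simp add: wre_cone_def)
qed

lemma wre_const_le_1:
  assumes lam: "decreasing_weights CARD('p) lam" and s: "s \<in> {1..CARD('p)}" and c0: "c0 \<ge> 0"
    and X: "\<And>j. emp_norm (X *v axis j 1) \<le> 1"
  shows "wre_const (X :: real ^ 'p ^ 'n) lam s c0 \<le> 1"
  using wre_const_le[OF axis_in_wre_cone[OF lam s c0], of X] X by (auto intro: order_trans)

lemma wre_const_antimono:
  assumes lam: "decreasing_weights CARD('p) lam" and s: "s \<in> {1..CARD('p)}" and c: "0 \<le> c" "c \<le> c'"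
  shows "wre_const (X :: real ^ 'p ^ 'n) lam s c' \<le> wre_const X lam s c"
  unfolding wre_const_def
proof (rule cINF_superset_mono)
  show "wre_cone lam s c - {0} \<noteq> ({} :: (real ^ 'p) set)"
    using axis_in_wre_cone[OF lam s c(1)] by (metis Diff_iff axis_eq_0_iff empty_iff singletonD zero_neq_one)
  show "bdd_below ((\<lambda>d. emp_norm (X *v d) / norm d) ` (wre_cone lam s c' - {0}))"
    by (intro bdd_belowI[of _ 0]) (auto simp: emp_norm_nonneg)
  show "wre_cone lam s c - {0} \<subseteq> wre_cone lam s c' - ({0} :: (real ^ 'p) set)"
  proof -
    have "(1 + c) * norm d * sqrt (\<Sum>j=1..s. (lam j)\<^sup>2)
        \<le> (1 + c') * norm d * sqrt (\<Sum>j=1..s. (lam j)\<^sup>2)" for d :: "real ^ 'p"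
      using c by (intro mult_right_mono) (auto simp: sum_nonneg)
    then show ?thesis unfolding wre_cone_def by (auto intro: order_trans)
  qed
qed simp

lemma sparse_head_tail:
  fixes b u :: "real ^ 'p"
  assumes lam: "decreasing_weights CARD('p) lam" and s: "s \<le> CARD('p)" "l0 b \<le> s"
  obtains h t where "0 \<le> h" "0 \<le> t" "sorted_l1 lam u = h + t"
    "h \<le> sqrt (\<Sum>j=1..s. (lam j)\<^sup>2) * norm u"
    "sorted_l1 lam b - sorted_l1 lam (b + u) \<le> h - t"
proof
  let ?h = "\<Sum>k=1..s. lam k * sharp u k" and ?t = "\<Sum>k=Suc s..CARD('p). lam k * sharp u k"
  have nonneg: "0 \<le> lam k * sharp u k" if "k \<in> {1..CARD('p)}" for k
    using lam sharp_nonneg[OF that, of u] that by (auto simp: decreasing_weights_def)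
  show "0 \<le> ?h" "0 \<le> ?t"
    using s nonneg by (auto intro!: sum_nonneg)
  have "{1..CARD('p)} = {1..s} \<union> {Suc s..CARD('p)}" using s(1) by auto
  then show "sorted_l1 lam u = ?h + ?t"
    unfolding sorted_l1_def by (simp add: sum.union_disjoint)
  show "sorted_l1 lam b - sorted_l1 lam (b + u) \<le> ?h - ?t"
    by (rule sparse_sorted_l1_decrease[OF lam s])
  have "?h\<^sup>2 \<le> (\<Sum>k=1..s. (lam k)\<^sup>2) * (\<Sum>k=1..s. (sharp u k)\<^sup>2)"
    by (rule Cauchy_Schwarz_ineq_sum)
  also have "\<dots> \<le> (\<Sum>k=1..s. (lam k)\<^sup>2) * (\<Sum>k=1..CARD('p). (sharp u k)\<^sup>2)"
    using s(1) by (intro mult_left_mono sum_mono2 sum_nonneg) auto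
  also have "\<dots> = (sqrt (\<Sum>k=1..s. (lam k)\<^sup>2) * norm u)\<^sup>2"
    unfolding sum_sharp_squared by (simp add: power_mult_distrib sum_nonneg)
  finally show "?h \<le> sqrt (\<Sum>k=1..s. (lam k)\<^sup>2) * norm u"
    by (rule power2_le_imp_le) (simp add: sum_nonneg)
qed

text \<open>Write \<open>|u|\<^sub>* = h + t\<close> with \<open>h \<le> \<Lambda> |u|\<^sub>2\<close> the head and \<open>t\<close> the tail. If the first term of the maximum
dominates, the error terms sum to \<open>(7 h - t) / 2\<close>. This is negative unless \<open>t \<le> 7 \<Lambda> |u|\<^sub>2\<close>, which puts
\<open>u\<close> in the cone with constant \<open>7\<close>. If the second one dominates, \<open>|u|\<^sub>*\<close> is at most \<open>\<Lambda> D / \<theta>\<close> outright. Both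
ways the error terms are at most \<open>7/2 \<Lambda> D / \<theta>\<close>, to be balanced against \<open>D\<^sup>2\<close>.\<close>

lemma slope_prediction_bound:
  fixes X :: "real ^ 'p ^ 'n"
  assumes lam: "decreasing_weights CARD('p) lam" and bh: "slope_estimator X lam (f + \<xi>) bh"
    and s: "s \<le> CARD('p)" "l0 b \<le> s" and \<theta>: "wre_const X lam s 7 > 0"
    and noise: "2 * (\<xi> \<bullet> (X *v (bh - b))) / real CARD('n)
      \<le> max (sorted_l1 lam (bh - b))
            (sqrt (\<Sum>j=1..s. (lam j)\<^sup>2) / wre_const X lam s 7 * emp_norm (X *v (bh - b)))"
  shows "1/2 * sorted_l1 lam (bh - b) + (emp_norm (X *v bh - f))\<^sup>2
           \<le> (emp_norm (X *v b - f))\<^sup>2 + 49 * (\<Sum>j=1..s. (lam j)\<^sup>2) / (16 * (wre_const X lam s 7)\<^sup>2)"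
proof -
  define u where "u = bh - b"
  define \<Lambda> where "\<Lambda> = sqrt (\<Sum>j=1..s. (lam j)\<^sup>2)"
  define \<theta> where "\<theta> = wre_const X lam s 7"
  define D where "D = emp_norm (X *v u)"
  have \<Lambda>2: "\<Lambda>\<^sup>2 = (\<Sum>j=1..s. (lam j)\<^sup>2)" and \<Lambda>0: "\<Lambda> \<ge> 0" by (simp_all add: \<Lambda>_def sum_nonneg)
  have \<theta>0: "\<theta> > 0" using \<theta> by (simp add: \<theta>_def)
  obtain h t where ht: "0 \<le> h" "0 \<le> t" "sorted_l1 lam u = h + t" "h \<le> \<Lambda> * norm u"
    "sorted_l1 lam b - sorted_l1 lam (b + u) \<le> h - t"
    unfolding \<Lambda>_def using sparse_head_tail[OF lam s] by blast
  have basic: "(emp_norm (X *v bh - f))\<^sup>2 + D\<^sup>2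
      \<le> (emp_norm (X *v b - f))\<^sup>2 + max (h + t) (\<Lambda> / \<theta> * D) + 2 * (h - t)"
    using slope_basic_inequality[OF lam bh, of b] noise ht(3,5)
    unfolding u_def[symmetric] \<Lambda>_def[symmetric] \<theta>_def[symmetric] D_def[symmetric]
    by (simp add: u_def)
  have amgm: "7 / 2 * (\<Lambda> / \<theta> * D) \<le> D\<^sup>2 + 49 * \<Lambda>\<^sup>2 / (16 * \<theta>\<^sup>2)"
  proof -
    have "0 \<le> (D - 7 / 4 * (\<Lambda> / \<theta>))\<^sup>2" by simp
    then show ?thesis by (simp add: power2_diff power_mult_distrib power_divide mult_ac)
  qed
  have "1/2 * (h + t) + max (h + t) (\<Lambda> / \<theta> * D) + 2 * (h - t) \<le> D\<^sup>2 + 49 * \<Lambda>\<^sup>2 / (16 * \<theta>\<^sup>2)"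
  proof (cases "h + t \<le> \<Lambda> / \<theta> * D")
    case True
    then have "max (h + t) (\<Lambda> / \<theta> * D) = \<Lambda> / \<theta> * D" by simp
    then have "1/2 * (h + t) + max (h + t) (\<Lambda> / \<theta> * D) + 2 * (h - t) \<le> 7 / 2 * (\<Lambda> / \<theta> * D)"
      using True ht(2) by argo
    then show ?thesis using amgm by linarith
  next
    case False
    then have eq: "1/2 * (h + t) + max (h + t) (\<Lambda> / \<theta> * D) + 2 * (h - t) = 7/2 * h - 1/2 * t"
      by (simp add: max_def field_simps)
    show ?thesis
    proof (cases "t \<le> 7 * (\<Lambda> * norm u)")
      case True
      then have "sorted_l1 lam u \<le> (1 + 7) * norm u * \<Lambda>"
        using ht(3,4) by (simp add: mult_ac)
      then have "u \<in> wre_cone lam s 7" by (simp add: wre_cone_def \<Lambda>_def)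
      then have "\<theta> * norm u \<le> D" unfolding \<theta>_def D_def by (rule wre_const_le)
      then have "norm u \<le> D / \<theta>" using \<theta>0 by (simp add: field_simps)
      then have "h \<le> \<Lambda> * (D / \<theta>)"
        using ht(4) mult_left_mono[OF _ \<Lambda>0, of "norm u" "D / \<theta>"] by linarith
      then have "h \<le> \<Lambda> / \<theta> * D" by simp
      then have "7/2 * h - 1/2 * t \<le> 7 / 2 * (\<Lambda> / \<theta> * D)"
        using ht(2) by argo
      then show ?thesis using amgm eq by linarith
    next
      case False
      then have "7/2 * h - 1/2 * t \<le> 0" using ht(4) by linarith
      moreover have "0 \<le> D\<^sup>2 + 49 * \<Lambda>\<^sup>2 / (16 * \<theta>\<^sup>2)" by simp
      ultimately show ?thesis using eq by linarith
    qed
  qed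
  then show ?thesis
    using basic ht(3) by (simp add: \<Lambda>2 \<theta>_def u_def)
qed

text \<open>For an exactly sparse linear model the basic inequality bounds \<open>2 D\<^sup>2\<close> by \<open>3 h - t\<close> or by \<open>3 \<Lambda> D / \<theta>\<close>. In
the first case \<open>u\<close> lies in the cone with constant \<open>3\<close>. In the second case \<open>u\<close> may lie outside, but then
\<open>4 \<Lambda> |u|\<^sub>2 < |u|\<^sub>* \<le> \<Lambda> D / \<theta>\<close>, which bounds \<open>|u|\<^sub>2\<close> even better than the cone condition.\<close>

lemma slope_estimation_bound:
  fixes X :: "real ^ 'p ^ 'n"
  assumes lam: "decreasing_weights CARD('p) lam" and bh: "slope_estimator X lam (X *v b + \<xi>) bh"
    and s: "s \<le> CARD('p)" "l0 b \<le> s" and \<theta>: "wre_const X lam s 3 > 0"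
    and \<Lambda>: "(\<Sum>j=1..s. (lam j)\<^sup>2) > 0"
    and noise: "2 * (\<xi> \<bullet> (X *v (bh - b))) / real CARD('n)
      \<le> max (sorted_l1 lam (bh - b))
            (sqrt (\<Sum>j=1..s. (lam j)\<^sup>2) / wre_const X lam s 3 * emp_norm (X *v (bh - b)))"
  shows "(norm (bh - b))\<^sup>2 \<le> 9 * (\<Sum>j=1..s. (lam j)\<^sup>2) / (4 * (wre_const X lam s 3) ^ 4)"
proof -
  define u where "u = bh - b"
  define \<Lambda> where "\<Lambda> = sqrt (\<Sum>j=1..s. (lam j)\<^sup>2)"
  define \<theta> where "\<theta> = wre_const X lam s 3"
  define D where "D = emp_norm (X *v u)"
  have \<Lambda>2: "\<Lambda>\<^sup>2 = (\<Sum>j=1..s. (lam j)\<^sup>2)" and \<Lambda>0: "\<Lambda> > 0"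
    using \<Lambda> by (simp_all add: \<Lambda>_def sum_nonneg)
  have \<theta>0: "\<theta> > 0" and D0: "D \<ge> 0" using \<theta> by (simp_all add: \<theta>_def D_def emp_norm_nonneg)
  obtain h t where ht: "0 \<le> h" "0 \<le> t" "sorted_l1 lam u = h + t" "h \<le> \<Lambda> * norm u"
    "sorted_l1 lam b - sorted_l1 lam (b + u) \<le> h - t"
    unfolding \<Lambda>_def using sparse_head_tail[OF lam s] by blast
  have D2: "(emp_norm (X *v bh - X *v b))\<^sup>2 = D\<^sup>2"
    by (simp add: D_def u_def matrix_vector_mult_diff_distrib)
  have "emp_norm (0 :: real ^ 'n) = 0" by (simp add: emp_norm_eq_norm)
  then have basic: "2 * D\<^sup>2 \<le> max (h + t) (\<Lambda> / \<theta> * D) + 2 * (h - t)"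
    using slope_basic_inequality[OF lam bh, of b] noise ht(3,5) D2
    unfolding u_def[symmetric] \<Lambda>_def[symmetric] \<theta>_def[symmetric] D_def[symmetric]
    by (simp add: u_def)
  have cone: "\<theta> * norm u \<le> D" if "h + t \<le> 4 * (\<Lambda> * norm u)"
  proof -
    have "u \<in> wre_cone lam s 3"
      using that ht(3) by (simp add: wre_cone_def \<Lambda>_def mult_ac)
    then show ?thesis unfolding \<theta>_def D_def by (rule wre_const_le)
  qed
  have "norm u \<le> 3 / 2 * \<Lambda> / \<theta>\<^sup>2"
  proof (cases "h + t \<le> \<Lambda> / \<theta> * D")
    case True
    then have "max (h + t) (\<Lambda> / \<theta> * D) = \<Lambda> / \<theta> * D" by simp
    then have "2 * D\<^sup>2 \<le> 3 * (\<Lambda> / \<theta> * D)" using basic True ht(2) by argo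
    moreover have "2 * D\<^sup>2 = 2 * (D * D)" "3 * (\<Lambda> / \<theta> * D) = 2 * (D * (3 / 2 * (\<Lambda> / \<theta>)))"
      by (simp_all add: power2_eq_square)
    ultimately have "D * D \<le> D * (3 / 2 * (\<Lambda> / \<theta>))" by linarith
    then have D: "D \<le> 3 / 2 * (\<Lambda> / \<theta>)"
    proof (cases "D = 0")
      case False
      then have "D > 0" using D0 by simp
      with \<open>D * D \<le> D * (3 / 2 * (\<Lambda> / \<theta>))\<close> show ?thesis
        by (simp only: mult_le_cancel_left_pos)
    qed (use \<Lambda>0 \<theta>0 in simp)
    have "\<theta> * norm u \<le> D"
    proof (cases "h + t \<le> 4 * (\<Lambda> * norm u)")
      case False
      then have "\<Lambda> * (4 * norm u) \<le> \<Lambda> * (D / \<theta>)" using True by simp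
      then have "4 * norm u \<le> D / \<theta>" using \<Lambda>0 by (simp only: mult_le_cancel_left_pos)
      then have "4 * (\<theta> * norm u) \<le> D" using \<theta>0 by (simp add: field_simps)
      moreover have "0 \<le> \<theta> * norm u" using \<theta>0 by simp
      ultimately show ?thesis by linarith
    qed (rule cone)
    then have "\<theta> * norm u \<le> 3 / 2 * (\<Lambda> / \<theta>)" using D by linarith
    then show ?thesis using \<theta>0 by (simp add: field_simps power2_eq_square)
  next
    case False
    then have le: "2 * D\<^sup>2 \<le> 3 * h - t" using basic by simp
    then have "t \<le> 3 * h" by (smt (verit) zero_le_power2)
    then have u: "\<theta> * norm u \<le> D" using ht(4) by (intro cone) linarith
    have "(\<theta> * norm u)\<^sup>2 \<le> D\<^sup>2" using u \<theta>0 by (intro power_mono) auto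
    then have "2 * (\<theta> * norm u)\<^sup>2 \<le> 3 * (\<Lambda> * norm u)" using le ht(2,4) by linarith
    then have "norm u * (\<theta>\<^sup>2 * norm u) \<le> norm u * (3 / 2 * \<Lambda>)"
      by (simp add: power2_eq_square mult_ac)
    then have "norm u = 0 \<or> \<theta>\<^sup>2 * norm u \<le> 3 / 2 * \<Lambda>"
      by (metis mult_left_le_imp_le norm_ge_zero order_le_less)
    then show ?thesis using \<theta>0 \<Lambda>0 by (auto simp: field_simps)
  qed
  then have "(norm u)\<^sup>2 \<le> (3 / 2 * \<Lambda> / \<theta>\<^sup>2)\<^sup>2" by (intro power_mono) auto
  also have "\<dots> = 9 * \<Lambda>\<^sup>2 / (4 * \<theta> ^ 4)"
    by (simp add: power_divide power_mult_distrib flip: power_mult)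
  finally show ?thesis by (simp add: \<Lambda>2 \<theta>_def u_def)
qed

section \<open>The noise event and the oracle inequality\<close>

text \<open>The general noise bound with \<open>\<delta> = (s / 2p) powr (s / \<theta>\<^sup>2)\<close> and the columns scaled by \<open>1 / sqrt n\<close>. The
constant is \<open>2 * 5 \<le> A\<close>. The level is chosen so that \<open>ln (1/\<delta>) = s ln (2p/s) / \<theta>\<^sup>2\<close>, and \<open>s ln (2p/s)\<close> is at most
\<open>\<Sum>\<^sub>j\<^sub>\<le>\<^sub>s ln (2p/j)\<close>, that is, the sum of the squared weights up to scaling. From \<open>\<theta> \<le> 1\<close> one gets
\<open>\<delta> \<le> s / 2p \<le> 1/2\<close>.\<close>

lemma slope_noise_event:
  fixes X :: "real ^ 'p ^ 'n" and \<xi> :: "'w \<Rightarrow> real ^ 'n"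
  assumes M: "prob_space M" and \<sigma>: "\<sigma> > 0" and \<xi>: "isotropic_normal M \<sigma> \<xi>"
    and s: "s \<in> {1..CARD('p)}" and A: "A \<ge> 2 * (4 + sqrt 2)"
    and lam: "\<forall>j\<in>{1..CARD('p)}.
           lam j = A * \<sigma> * sqrt (ln (2 * real CARD('p) / real j) / real CARD('n))"
    and X: "\<And>j. emp_norm (X *v axis j 1) \<le> 1" and \<theta>: "0 < \<theta>" "\<theta> \<le> 1"
  shows "\<exists>E\<in>sets M. 1 - 1/2 * (real s / (2 * real CARD('p))) powr (real s / \<theta>\<^sup>2) \<le> measure M E \<and>
    (\<forall>\<omega>\<in>E. \<forall>u. 2 * (\<xi> \<omega> \<bullet> (X *v u)) / real CARD('n)
       \<le> max (sorted_l1 lam u) (sqrt (\<Sum>j=1..s. (lam j)\<^sup>2) / \<theta> * emp_norm (X *v u)))"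
proof -
  let ?p = "real CARD('p)" and ?n = "real CARD('n)"
  define \<delta> where "\<delta> = (real s / (2 * ?p)) powr (real s / \<theta>\<^sup>2)"
  define T where "T = ln (1 / \<delta>)"
  define x where "x j = (1 / sqrt ?n) *\<^sub>R (X *v axis j 1)" for j
  have n: "?n > 0" by simp
  have q: "0 < real s / (2 * ?p)" "real s / (2 * ?p) \<le> 1 / 2"
    using s by (auto simp: field_simps)
  have "\<delta> \<le> (real s / (2 * ?p)) powr 1"
    unfolding \<delta>_def
  proof (rule powr_mono')
    have "\<theta>\<^sup>2 \<le> 1" using \<theta> by (simp add: power_le_one)
    then show "1 \<le> real s / \<theta>\<^sup>2" using s \<theta> by (simp add: field_simps)
  qed (use q in auto)
  moreover have "(real s / (2 * ?p)) powr 1 = real s / (2 * ?p)" by (rule powr_one) (use q in auto)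
  ultimately have "\<delta> \<le> 1 / 2" using q by linarith
  moreover have "0 < \<delta>" unfolding \<delta>_def using s by simp
  ultimately have \<delta>: "0 < \<delta>" "\<delta> \<le> 1 / 2" by auto
  have Tq: "T = real s / \<theta>\<^sup>2 * ln (2 * ?p / real s)"
    using q s by (simp add: T_def \<delta>_def ln_div ln_powr algebra_simps)
  have T0: "T \<ge> 0" using \<delta> by (simp add: T_def)
  have "10 \<le> 2 * (4 + sqrt (2 :: real))" by simp
  then have A10: "A \<ge> 10" using A by (rule order_trans)
  have xsum: "(\<Sum>j\<in>UNIV. (u $ j) *\<^sub>R x j) = (1 / sqrt ?n) *\<^sub>R (X *v u)" for u
  proof -
    have "X *v u = (\<Sum>j\<in>UNIV. (u $ j) *\<^sub>R column j X)"
      by (simp add: matrix_mult_sum scalar_mult_eq_scaleR)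
    then show ?thesis
      by (simp add: x_def scaleR_sum_right mult.commute matrix_vector_mult_basis)
  qed
  have xnorm: "norm (x j) \<le> 1" for j
    using X[of j] by (simp add: x_def emp_norm_eq_norm)
  from gaussian_noise_bound[where x = x, OF M \<sigma> \<xi> xnorm \<delta>, folded T_def]
  obtain E where E: "E \<in> sets M" "1 - \<delta> / 2 \<le> measure M E"
    and bound: "\<forall>\<omega>\<in>E. \<forall>u \<phi>. sorts_decreasing \<phi> (\<lambda>j. \<bar>u j\<bar>) \<longrightarrow>
       (\<Sum>j\<in>UNIV. u j *\<^sub>R x j) \<bullet> \<xi> \<omega>
         \<le> 5 * \<sigma> * max (\<Sum>k=1..CARD('p). \<bar>u (\<phi> k)\<bar> * sqrt (ln (2 * ?p / real k)))
                     (sqrt T * norm (\<Sum>j\<in>UNIV. u j *\<^sub>R x j))"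
    by (elim bexE conjE) (rule that)
  have level: "A * \<sigma> / sqrt ?n * sqrt T \<le> sqrt (\<Sum>j=1..s. (lam j)\<^sup>2) / \<theta>"
  proof -
    have "T * \<theta>\<^sup>2 = real s * ln (2 * ?p / real s)"
      unfolding Tq using \<theta> by simp
    moreover have "(A * \<sigma> / sqrt ?n * sqrt T * \<theta>)\<^sup>2 = (A * \<sigma>)\<^sup>2 / ?n * (T * \<theta>\<^sup>2)"
      using T0 by (simp add: power_mult_distrib power_divide)
    ultimately have "(A * \<sigma> / sqrt ?n * sqrt T * \<theta>)\<^sup>2
        = (A * \<sigma>)\<^sup>2 / ?n * (real s * ln (2 * ?p / real s))"
      by simp
    also have "\<dots> = (\<Sum>j=1..s. (A * \<sigma>)\<^sup>2 / ?n * ln (2 * ?p / real s))"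
      by simp
    also have "\<dots> \<le> (\<Sum>j=1..s. (lam j)\<^sup>2)"
    proof (rule sum_mono)
      fix j assume j: "j \<in> {1..s}"
      have "2 * ?p / real s \<le> 2 * ?p / real j"
        using j by (intro divide_left_mono) auto
      moreover have "0 < 2 * ?p / real s" using s by simp
      ultimately have ln: "ln (2 * ?p / real s) \<le> ln (2 * ?p / real j)"
        by (rule ln_mono)
      have "0 \<le> ln (2 * ?p / real j)"
        using j s by (intro ln_ge_zero) (auto simp: field_simps)
      then have "(lam j)\<^sup>2 = (A * \<sigma>)\<^sup>2 / ?n * ln (2 * ?p / real j)"
        using lam j s by (simp add: power_mult_distrib)
      then show "(A * \<sigma>)\<^sup>2 / ?n * ln (2 * ?p / real s) \<le> (lam j)\<^sup>2"
        using mult_left_mono[OF ln, of "(A * \<sigma>)\<^sup>2 / ?n"] by simp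
    qed
    finally have "A * \<sigma> / sqrt ?n * sqrt T * \<theta> \<le> sqrt (\<Sum>j=1..s. (lam j)\<^sup>2)"
      by (rule real_le_rsqrt)
    then show ?thesis using \<theta> by (simp add: field_simps)
  qed
  show ?thesis
  proof (intro bexI[of _ E] conjI ballI allI)
    fix \<omega> and u :: "real ^ 'p"
    assume \<omega>: "\<omega> \<in> E"
    obtain \<phi> where \<phi>: "sorts_decreasing \<phi> (\<lambda>i. \<bar>u $ i\<bar>)"
      using ex_sorts_decreasing[of "\<lambda>i. \<bar>u $ i\<bar>"] by blast
    define H where "H = (\<Sum>k=1..CARD('p). \<bar>u $ \<phi> k\<bar> * sqrt (ln (2 * ?p / real k)))"
    define G where "G = sqrt T * emp_norm (X *v u)"
    have G0: "0 \<le> G" using T0 by (simp add: G_def emp_norm_nonneg)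
    have "2 * (\<xi> \<omega> \<bullet> (X *v u)) / ?n = 2 / sqrt ?n * ((\<Sum>j\<in>UNIV. (u $ j) *\<^sub>R x j) \<bullet> \<xi> \<omega>)"
      unfolding xsum by (simp add: inner_commute field_simps)
    also have "\<dots> \<le> 2 / sqrt ?n * (5 * \<sigma> * max H G)"
      using bound[rule_format, OF \<omega> \<phi>] unfolding xsum H_def G_def
      by (intro mult_left_mono) (auto simp: emp_norm_eq_norm)
    also have "\<dots> = 10 * \<sigma> / sqrt ?n * max H G" by simp
    also have "\<dots> \<le> A * \<sigma> / sqrt ?n * max H G"
      using A10 \<sigma> G0 by (intro mult_right_mono divide_right_mono) auto
    also have "\<dots> = max (A * \<sigma> / sqrt ?n * H) (A * \<sigma> / sqrt ?n * G)"
      using A10 \<sigma> by (intro max_mult_distrib_left[THEN trans]) auto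
    also have "\<dots> \<le> max (sorted_l1 lam u) (sqrt (\<Sum>j=1..s. (lam j)\<^sup>2) / \<theta> * emp_norm (X *v u))"
    proof (rule max.mono)
      have "sorted_l1 lam u = (\<Sum>k=1..CARD('p). lam k * \<bar>u $ \<phi> k\<bar>)"
        by (rule sorted_l1_eq_of_sorts_decreasing[OF \<phi>])
      also have "\<dots> = A * \<sigma> / sqrt ?n * H"
        unfolding H_def sum_distrib_left
        by (intro sum.cong) (auto simp: lam real_sqrt_divide)
      finally show "A * \<sigma> / sqrt ?n * H \<le> sorted_l1 lam u" by simp
      show "A * \<sigma> / sqrt ?n * G \<le> sqrt (\<Sum>j=1..s. (lam j)\<^sup>2) / \<theta> * emp_norm (X *v u)"
        using mult_right_mono[OF level emp_norm_nonneg[of "X *v u"]] by (simp add: G_def mult_ac)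
    qed
    finally show "2 * (\<xi> \<omega> \<bullet> (X *v u)) / ?n
       \<le> max (sorted_l1 lam u) (sqrt (\<Sum>j=1..s. (lam j)\<^sup>2) / \<theta> * emp_norm (X *v u))" .
  qed (use E in \<open>auto simp: \<delta>_def\<close>)
qed

text \<open>The events for the two parts differ only in the level \<open>\<delta>\<close>, given by \<open>\<theta> = \<theta>(s, 7)\<close> and
\<open>\<theta> = \<theta>(s, 3)\<close>. The second constant is positive because the smaller cone has the larger infimum.\<close>

theorem corollary6p2:
  fixes M :: "'w measure"
    and X :: "real ^ 'p ^ 'n"
    and \<xi> :: "'w \<Rightarrow> real ^ 'n"
    and bhat :: "real ^ 'n \<Rightarrow> 'w \<Rightarrow> real ^ 'p"
    and \<sigma> A :: real and s :: nat and lam :: "nat \<Rightarrow> real"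
  assumes "prob_space M"
    and "\<sigma> > 0"
    and "isotropic_normal M \<sigma> \<xi>"
    and "s \<in> {1..CARD('p)}"
    and "A \<ge> 2 * (4 + sqrt 2)"
    and "\<And>j. j \<in> {1..CARD('p)} \<Longrightarrow>
           lam j = A * \<sigma> * sqrt (ln (2 * real CARD('p) / real j) / real CARD('n))"
    and "WRE X lam s 7"
    and "\<And>f \<omega>. \<omega> \<in> space M \<Longrightarrow> slope_estimator X lam (f + \<xi> \<omega>) (bhat f \<omega>)"
  shows
    "holds_with_prob M
       (1 - 1/2 * (real s / (2 * real CARD('p))) powr (real s / (wre_const X lam s 7)\<^sup>2))
       (\<lambda>\<omega>. \<forall>b f. l0 b \<le> s \<longrightarrow>
          1/2 * sorted_l1 lam (bhat f \<omega> - b) + (emp_norm (X *v bhat f \<omega> - f))\<^sup>2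
            \<le> (emp_norm (X *v b - f))\<^sup>2
               + 49 * (\<Sum>j=1..s. (lam j)\<^sup>2) / (16 * (wre_const X lam s 7)\<^sup>2))
     \<and> (\<forall>f bs. f = X *v bs \<and> l0 bs \<le> s \<longrightarrow>
          holds_with_prob M
            (1 - 1/2 * (real s / (2 * real CARD('p))) powr (real s / (wre_const X lam s 3)\<^sup>2))
            (\<lambda>\<omega>. (norm (bhat f \<omega> - bs))\<^sup>2
                   \<le> 9 * (\<Sum>j=1..s. (lam j)\<^sup>2) / (4 * (wre_const X lam s 3) ^ 4)))"
proof -
  have "0 < 2 * (4 + sqrt (2 :: real))" by (simp add: add_pos_pos)
  then have A0: "A > 0" using assms(5) by (rule less_le_trans)
  have ln_pos: "0 < ln (2 * real CARD('p) / real j)" if "j \<in> {1..CARD('p)}" for j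
    using that by simp
  have lam_pos: "0 < lam j" if "j \<in> {1..CARD('p)}" for j
    using that A0 assms(2) ln_pos[OF that] by (simp add: assms(6))
  have weights: "decreasing_weights CARD('p) lam"
    unfolding decreasing_weights_def
  proof (intro conjI ballI allI impI)
    fix k assume "k \<in> {1..CARD('p)}"
    then show "0 \<le> lam k" using lam_pos by (simp add: less_imp_le)
  next
    fix k assume k: "1 \<le> k" "k < CARD('p)"
    have "ln (2 * real CARD('p) / real (Suc k)) \<le> ln (2 * real CARD('p) / real k)"
      using k by (intro ln_mono divide_left_mono) auto
    then show "lam (Suc k) \<le> lam k"
      using k A0 assms(2) by (simp add: assms(6) divide_right_mono)
  qed
  have X: "\<And>j. emp_norm (X *v axis j 1) \<le> 1" and \<theta>7: "wre_const X lam s 7 > 0"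
    using assms(7) by (simp_all add: WRE_def)
  have \<theta>7_le: "wre_const X lam s 7 \<le> 1" and \<theta>3_le: "wre_const X lam s 3 \<le> 1"
    using wre_const_le_1[OF weights assms(4) _ X] by auto
  have "wre_const X lam s 7 \<le> wre_const X lam s 3"
    by (rule wre_const_antimono[OF weights assms(4)]) auto
  then have \<theta>3: "wre_const X lam s 3 > 0" using \<theta>7 by linarith
  have s: "s \<le> CARD('p)" using assms(4) by simp
  have \<Lambda>: "(\<Sum>j=1..s. (lam j)\<^sup>2) > 0"
    using assms(4) lam_pos by (intro sum_pos) (auto simp: zero_less_power2 less_imp_neq[symmetric])
  have "\<forall>j\<in>{1..CARD('p)}. lam j = A * \<sigma> * sqrt (ln (2 * real CARD('p) / real j) / real CARD('n))"
    using assms(6) by blast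
  note event = slope_noise_event[OF assms(1-5) this X]
  show ?thesis
  proof (intro conjI allI impI)
    from event[OF \<theta>7 \<theta>7_le]
    obtain E where E: "E \<in> sets M"
      "1 - 1/2 * (real s / (2 * real CARD('p))) powr (real s / (wre_const X lam s 7)\<^sup>2) \<le> measure M E"
      and noise: "\<forall>\<omega>\<in>E. \<forall>u. 2 * (\<xi> \<omega> \<bullet> (X *v u)) / real CARD('n)
       \<le> max (sorted_l1 lam u)
             (sqrt (\<Sum>j=1..s. (lam j)\<^sup>2) / wre_const X lam s 7 * emp_norm (X *v u))"
      by (elim bexE conjE) (rule that)
    show "holds_with_prob M
       (1 - 1/2 * (real s / (2 * real CARD('p))) powr (real s / (wre_const X lam s 7)\<^sup>2))
       (\<lambda>\<omega>. \<forall>b f. l0 b \<le> s \<longrightarrow>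
          1/2 * sorted_l1 lam (bhat f \<omega> - b) + (emp_norm (X *v bhat f \<omega> - f))\<^sup>2
            \<le> (emp_norm (X *v b - f))\<^sup>2
               + 49 * (\<Sum>j=1..s. (lam j)\<^sup>2) / (16 * (wre_const X lam s 7)\<^sup>2))"
      unfolding holds_with_prob_def
    proof (intro bexI[of _ E] conjI ballI allI impI)
      fix \<omega> f and b :: "real ^ 'p"
      assume \<omega>: "\<omega> \<in> E" and b: "l0 b \<le> s"
      then have "\<omega> \<in> space M" using E(1) sets.sets_into_space by blast
      then have "slope_estimator X lam (f + \<xi> \<omega>) (bhat f \<omega>)" by (rule assms(8))
      then show "1/2 * sorted_l1 lam (bhat f \<omega> - b) + (emp_norm (X *v bhat f \<omega> - f))\<^sup>2
            \<le> (emp_norm (X *v b - f))\<^sup>2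
               + 49 * (\<Sum>j=1..s. (lam j)\<^sup>2) / (16 * (wre_const X lam s 7)\<^sup>2)"
        by (rule slope_prediction_bound[OF weights _ s b \<theta>7 noise[rule_format, OF \<omega>]])
    qed (use E in auto)
  next
    fix f bs assume f: "f = X *v bs \<and> l0 bs \<le> s"
    from event[OF \<theta>3 \<theta>3_le]
    obtain E where E: "E \<in> sets M"
      "1 - 1/2 * (real s / (2 * real CARD('p))) powr (real s / (wre_const X lam s 3)\<^sup>2) \<le> measure M E"
      and noise: "\<forall>\<omega>\<in>E. \<forall>u. 2 * (\<xi> \<omega> \<bullet> (X *v u)) / real CARD('n)
       \<le> max (sorted_l1 lam u)
             (sqrt (\<Sum>j=1..s. (lam j)\<^sup>2) / wre_const X lam s 3 * emp_norm (X *v u))"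
      by (elim bexE conjE) (rule that)
    show "holds_with_prob M
            (1 - 1/2 * (real s / (2 * real CARD('p))) powr (real s / (wre_const X lam s 3)\<^sup>2))
            (\<lambda>\<omega>. (norm (bhat f \<omega> - bs))\<^sup>2
                   \<le> 9 * (\<Sum>j=1..s. (lam j)\<^sup>2) / (4 * (wre_const X lam s 3) ^ 4))"
      unfolding holds_with_prob_def
    proof (intro bexI[of _ E] conjI ballI)
      fix \<omega> assume \<omega>: "\<omega> \<in> E"
      then have "\<omega> \<in> space M" using E(1) sets.sets_into_space by blast
      then have "slope_estimator X lam (f + \<xi> \<omega>) (bhat f \<omega>)" by (rule assms(8))
      then have "slope_estimator X lam (X *v bs + \<xi> \<omega>) (bhat f \<omega>)" using f by simp
      then show "(norm (bhat f \<omega> - bs))\<^sup>2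
                   \<le> 9 * (\<Sum>j=1..s. (lam j)\<^sup>2) / (4 * (wre_const X lam s 3) ^ 4)"
        by (rule slope_estimation_bound[OF weights _ s conjunct2[OF f] \<theta>3 \<Lambda>
              noise[rule_format, OF \<omega>]])
    qed (use E in auto)
  qed
qed

end
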